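(* Let $R_{00}(\lambda)=\lambda(5-4\lambda)$, $R_{\frac12\frac12}(\lambda)=-(\lambda-2)(4\lambda-3)$, $R_{\frac120}(\lambda)=-4\lambda^2+9\lambda-3$, $R_{0\frac12}(\lambda)=-4\lambda^2+7\lambda-1$. Then the multiset of eigenvalues (each repeated according to its multiplicity) of the magnetic Laplacian $\mathcal{L}_N^{(\alpha,\beta)}$ is as follows. (1) For every integer $N\ge 1$, $\sigma(\mathcal{L}_N^{(\frac12,\frac12)})$ is the multiset sum of: $\frac12$ with multiplicity $\frac{3^N+3}{2}$; $\frac34$ with multiplicity $\frac{3^{N-1}-1}{2}$; $\frac54$ with multiplicity $\frac{3^{N-1}+3}{2}$; $2$ with multiplicity $1$; for each $k\in\{0,1,\dots,N-2\}$, every point of $R_{\frac12\frac12}^{-1}\circ R_{00}^{-k}(\frac34)$, with multiplicity $\frac{3^{N-k-2}+3}{2}$; for each $k\in\{0,1,\dots,N-3\}$, every point of $R_{\frac12\frac12}^{-1}\circ R_{00}^{-k}(\frac54)$, with multiplicity $\frac{3^{N-k-2}-1}{2}$. (2) For every integer $N\ge 2$, $\sigma(\mathcal{L}_N^{(\frac12,0)})$ is the multiset sum of: $\frac12$ with multiplicity $\frac{3^N+3}{2}$; $1$ with multiplicity $1$; $\frac54$ with multiplicity $\frac{3^{N-1}-1}{2}$; $\frac74$ with multiplicity $\frac{3^{N-1}+3}{2}$; every point of $R_{\frac120}^{-1}(\frac34)$ with multiplicity $\frac{3^{N-2}-1}{2}$; every point of $R_{\frac120}^{-1}(\frac54)$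 with multiplicity $\frac{3^{N-2}+3}{2}$; for each $k\in\{0,\dots,N-3\}$, every point of $R_{\frac120}^{-1}\circ R_{\frac12\frac12}^{-1}\circ R_{00}^{-k}(\frac34)$ with multiplicity $\frac{3^{N-k-3}+3}{2}$; for each $k\in\{0,\dots,N-4\}$, every point of $R_{\frac120}^{-1}\circ R_{\frac12\frac12}^{-1}\circ R_{00}^{-k}(\frac54)$ with multiplicity $\frac{3^{N-k-3}-1}{2}$. (3) For every integer $N\ge 2$, $\sigma(\mathcal{L}_N^{(0,\frac12)})$ is the multiset sum of: $\frac14$ with multiplicity $\frac{3^{N-1}+3}{2}$; $\frac34$ with multiplicity $\frac{3^{N-1}-1}{2}$; $1$ with multiplicity $1$; $\frac32$ with multiplicity $\frac{3^N+3}{2}$; every point of $R_{0\frac12}^{-1}(\frac34)$ with multiplicity $\frac{3^{N-2}-1}{2}$; every point of $R_{0\frac12}^{-1}(\frac54)$ with multiplicity $\frac{3^{N-2}+3}{2}$; for each $k\in\{0,\dots,N-3\}$, every point of $R_{0\frac12}^{-1}\circ R_{\frac12\frac12}^{-1}\circ R_{00}^{-k}(\frac34)$ with multiplicity $\frac{3^{N-k-3}+3}{2}$; for each $k\in\{0,\dots,N-4\}$, every point of $R_{0\frac12}^{-1}\circ R_{\frac12\frac12}^{-1}\circ R_{00}^{-k}(\frac54)$ with multiplicity $\frac{3^{N-k-3}-1}{2}$.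
   Context: Sierpinski gasket graphs: let $x_0=(0,0)$, $x_1=(\frac12,\frac{\sqrt3}{2})$, $x_2=(1,0)$, $\Phi_i(x)=\frac12(x-x_i)+x_i$. Let $\mathfrak G_0$ be the complete graph on $\{x_0,x_1,x_2\}$ (straight edges in $\mathbb R^2$) and $\mathfrak G_N=\bigcup_{i=0}^2\Phi_i(\mathfrak G_{N-1})$ (unions of vertex sets and edge sets). Put $G_N=2^N\mathfrak G_N$ (coordinates multiplied by $2^N$), with vertex set $V_N$; all edges have length 1, $G_{N-1}\subset G_N$, $|V_N|=\frac{3^{N+1}+3}{2}$. $G_N$ is a subgraph of the triangular lattice $\mathbb T$ (vertices $\mathbb Z(1,0)+\mathbb Z(\frac12,\frac{\sqrt3}2)$, edges between points at distance 1). Unitary connection and magnetic Laplacian: a unitary connection on a graph assigns to each oriented edge $xy$ a complex number $\omega_{xy}$ with $|\omega_{xy}|=1$ and $\omega_{yx}=\overline{\omega_{xy}}$. The magnetic Laplacian on $G_N$ is $(\mathcal{L}^\omega_N u)(x)=\sum_{y\sim x}\frac{1}{\deg_{G_N}(x)}(u(x)-\omega_{xy}u(y))$, self-adjoint on $L^2(V_N,\deg_{G_N})$. For $\alpha,\beta\in[0,1)$, $\mathcal{L}_N^{(\alpha,\beta)}$ denotes $\mathcal{L}^\omega_N$ where $\omega$ is the restriction to $G_N$ of a unitary connection on $\mathbb T$ whose holonomy (product of $\omega$ along the cycle) around every upward-pointing unit triangle traversed counterclockwise is $e^{2\pi i\alpha}$ and around every downward-pointing unit triangle traversed counterclockwise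 is $e^{2\pi i\beta}$; this is unique up to gauge equivalence, so its spectrum is well defined. Preimages: for a polynomial $f$ of degree $d$ and $a\in\mathbb C$, $f^{-k}(a)$ is the multiset of the $d^k$ roots (with multiplicity) of $f^{\circ k}(z)=a$; for a multiset $S$, $g^{-1}(S)$ is the multiset union of $g^{-1}(w)$, $w\in S$. "Every point of $S$ with multiplicity $m$" means each element of the multiset $S$ contributes $m$ copies. *)

theory Defs
  imports "HOL-Analysis.Analysis" "HOL-Computational_Algebra.Polynomial"
    "HOL-Library.Multiset" "Jordan_Normal_Form.Char_Poly"
begin

text \<open>Points of the plane R^2 are represented as complex numbers.\<close>

definition omega0 :: complex where
  "omega0 = Complex (1/2) (sqrt 3 / 2)"

definition sg_x :: "nat \<Rightarrow> complex" where
  "sg_x i = (if i = 0 then 0 else if i = 1 then omega0 else 1)"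

definition sg_Phi :: "nat \<Rightarrow> complex \<Rightarrow> complex" where
  "sg_Phi i z = (z - sg_x i) / 2 + sg_x i"

fun sgV0 :: "nat \<Rightarrow> complex set" where
  "sgV0 0 = {sg_x 0, sg_x 1, sg_x 2}"
| "sgV0 (Suc n) = (\<Union>i\<in>{0,1,2}. sg_Phi i ` sgV0 n)"

fun sgE0 :: "nat \<Rightarrow> (complex \<times> complex) set" where
  "sgE0 0 = {(a, b). a \<in> {sg_x 0, sg_x 1, sg_x 2} \<and> b \<in> {sg_x 0, sg_x 1, sg_x 2} \<and> a \<noteq> b}"
| "sgE0 (Suc n) = (\<Union>i\<in>{0,1,2}. map_prod (sg_Phi i) (sg_Phi i) ` sgE0 n)"

definition GV :: "nat \<Rightarrow> complex set" where
  "GV N = (\<lambda>z. 2 ^ N * z) ` sgV0 N"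

definition GE :: "nat \<Rightarrow> (complex \<times> complex) set" where
  "GE N = map_prod (\<lambda>z. 2 ^ N * z) (\<lambda>z. 2 ^ N * z) ` sgE0 N"

definition tri_lattice :: "complex set" where
  "tri_lattice = {of_int m + of_int n * omega0 | m n. True}"

definition tri_edge :: "complex \<Rightarrow> complex \<Rightarrow> bool" where
  "tri_edge x y \<longleftrightarrow> x \<in> tri_lattice \<and> y \<in> tri_lattice \<and> cmod (x - y) = 1"

text \<open>A unitary connection on T whose holonomy around every upward unit triangle
  (p, p+1, p+omega0), traversed counterclockwise, is exp(2 pi i alpha), and around every downward
  unit triangle (p+1, p+1+omega0, p+omega0), traversed counterclockwise, is exp(2 pi i beta).\<close>
definition unitary_connection_T :: "(complex \<Rightarrow> complex \<Rightarrow> complex) \<Rightarrow> bool" where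
  "unitary_connection_T w \<longleftrightarrow>
     (\<forall>x y. tri_edge x y \<longrightarrow> cmod (w x y) = 1 \<and> w y x = cnj (w x y))"

definition conn_with_flux :: "real \<Rightarrow> real \<Rightarrow> (complex \<Rightarrow> complex \<Rightarrow> complex) \<Rightarrow> bool" where
  "conn_with_flux \<alpha> \<beta> w \<longleftrightarrow> unitary_connection_T w \<and>
     (\<forall>p\<in>tri_lattice.
        w p (p + 1) * w (p + 1) (p + omega0) * w (p + omega0) p = exp (2 * pi * \<i> * of_real \<alpha>)
      \<and> w (p + 1) (p + 1 + omega0) * w (p + 1 + omega0) (p + omega0) * w (p + omega0) (p + 1)
          = exp (2 * pi * \<i> * of_real \<beta>))"

definition nbrs :: "'a set \<Rightarrow> ('a \<times> 'a) set \<Rightarrow> 'a \<Rightarrow> 'a set" where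
  "nbrs V E x = {y \<in> V. (x, y) \<in> E}"

definition mag_lap :: "'a set \<Rightarrow> ('a \<times> 'a) set \<Rightarrow> ('a \<Rightarrow> 'a \<Rightarrow> complex)
    \<Rightarrow> ('a \<Rightarrow> complex) \<Rightarrow> 'a \<Rightarrow> complex" where
  "mag_lap V E w u x =
     (\<Sum>y\<in>nbrs V E x. (u x - w x y * u y) / of_nat (card (nbrs V E x)))"

text \<open>Multiset of eigenvalues (with algebraic multiplicity) of a linear operator on the functions
  on a finite set V: roots of the characteristic polynomial of its matrix with respect to the
  standard basis (indexed by an arbitrary enumeration of V; the result does not depend on it).\<close>
definition op_spectrum :: "'a set \<Rightarrow> (('a \<Rightarrow> complex) \<Rightarrow> 'a \<Rightarrow> complex) \<Rightarrow> complex multiset" where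
  "op_spectrum V L =
     (let xs = (SOME xs. distinct xs \<and> set xs = V); n = length xs
      in proots (char_poly (mat n n (\<lambda>(i, j). L (\<lambda>z. if z = xs ! j then 1 else 0) (xs ! i)))))"

definition sg_spectrum :: "nat \<Rightarrow> (complex \<Rightarrow> complex \<Rightarrow> complex) \<Rightarrow> complex multiset" where
  "sg_spectrum N w = op_spectrum (GV N) (mag_lap (GV N) (GE N) w)"

definition preim :: "complex poly \<Rightarrow> nat \<Rightarrow> complex \<Rightarrow> complex multiset" where
  "preim f k a = proots (((\<lambda>q. pcompose f q) ^^ k) [:0, 1:] - [:a:])"

definition preim_mset :: "complex poly \<Rightarrow> complex multiset \<Rightarrow> complex multiset" where
  "preim_mset g S = sum_mset (image_mset (\<lambda>w. preim g 1 w) S)"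

definition R00 :: "complex poly" where "R00 = [:0, 5, -4:]"
definition Rhh :: "complex poly" where "Rhh = [:-6, 11, -4:]"
definition Rh0 :: "complex poly" where "Rh0 = [:-3, 9, -4:]"
definition R0h :: "complex poly" where "R0h = [:-1, 7, -4:]"

end

theory Submission
  imports Defs
begin

text \<open>
  The graph \<open>G\<^sub>N\<^sub>+\<^sub>1\<close> arises from \<open>2 G\<^sub>N\<close> by inserting the three midpoints of the sides of each cell. The
  midpoints of different cells are not adjacent, so eliminating them from \<open>\<lambda> - L\<^sub>N\<^sub>+\<^sub>1\<close> by row operations is a
  computation inside one cell. When all fluxes are \<open>0\<close> or \<open>1/2\<close> (holonomies \<open>e, f = \<plusminus>1\<close> for upward and downward
  triangles) the result is a scalar multiple of \<open>R(\<lambda>) - L\<^sub>N\<close>, where \<open>L\<^sub>N\<close> belongs to the connection obtained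
  by parallel transport along the sides of length two, whose holonomies are all \<open>e f\<close>. Taking determinants,
  with \<open>v = |V\<^sub>N|\<close>, \<open>D\<close> the determinant of the three midpoint rows and columns of a cell, and \<open>\<delta>\<close> and \<open>\<psi>\<close>
  the scalars of the row operations and of the result,
  \<open>\<delta>(\<lambda>)\<^sup>v det(\<lambda> - L\<^sub>N\<^sub>+\<^sub>1) = D(\<lambda>)\<^bsup>3^N\<^esup> \<psi>(\<lambda>)\<^sup>v det(R(\<lambda>) - L\<^sub>N)\<close>
  holds without exceptional values of \<open>\<lambda>\<close>. Comparing roots turns this into a recursion for multisets: fluxes
  \<open>(0,1/2)\<close> and \<open>(1/2,0)\<close> lead to \<open>(1/2,1/2)\<close>, which leads to \<open>(0,0)\<close>, which reproduces itself.
\<close>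

section \<open>Determinants over finite index sets\<close>

definition fmat :: "'a list \<Rightarrow> ('a \<Rightarrow> 'a \<Rightarrow> 'b) \<Rightarrow> 'b Matrix.mat" where
  "fmat xs f = Matrix.mat (length xs) (length xs) (\<lambda>(i, j). f (xs ! i) (xs ! j))"

definition enum_of :: "'a set \<Rightarrow> 'a list" where
  "enum_of V = (SOME xs. distinct xs \<and> set xs = V)"

text \<open>Determinants are indexed by sets rather than by positions, so that old vertices and
  midpoints can serve directly as blocks. By \<open>fdet_eq\<close> the chosen enumeration does not
  matter.\<close>

definition fdet :: "'a set \<Rightarrow> ('a \<Rightarrow> 'a \<Rightarrow> 'b :: idom) \<Rightarrow> 'b" where
  "fdet V f = Determinant.det (fmat (enum_of V) f)"

lemma enum_of: assumes "finite V" shows "distinct (enum_of V)" "set (enum_of V) = V"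
proof -
  obtain xs where "distinct xs \<and> set xs = V"
    using finite_distinct_list[OF assms] by auto
  then have "distinct (enum_of V) \<and> set (enum_of V) = V"
    unfolding enum_of_def by (rule someI)
  then show "distinct (enum_of V)" "set (enum_of V) = V" by auto
qed

lemma fmat_carrier [simp]: "fmat xs f \<in> carrier_mat (length xs) (length xs)"
  by (simp add: fmat_def)

lemma fmat_cong:
  assumes "\<And>x y. x \<in> set xs \<Longrightarrow> y \<in> set xs \<Longrightarrow> f x y = g x y"
  shows "fmat xs f = fmat xs g"
  unfolding fmat_def using assms by (intro cong_mat) auto

lemma sum_index_distinct:
  assumes "distinct xs"
  shows "(\<Sum>i<length xs. h (xs ! i)) = (\<Sum>x\<in>set xs. h x)"
  by (rule sum.reindex_bij_betw[OF bij_betw_nth[OF assms refl refl]])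

lemma fmat_mult:
  fixes f g :: "'a \<Rightarrow> 'a \<Rightarrow> 'b :: comm_ring_1"
  assumes "distinct zs" "length zs = length xs"
  shows "Matrix.mat (length xs) (length xs) (\<lambda>(i, j). f (xs ! i) (zs ! j))
           * Matrix.mat (length xs) (length xs) (\<lambda>(i, j). g (zs ! i) (ys ! j))
         = Matrix.mat (length xs) (length xs) (\<lambda>(i, j). \<Sum>z\<in>set zs. f (xs ! i) z * g z (ys ! j))"
  using sum_index_distinct[OF assms(1)] assms(2)
  by (intro eq_matI) (auto simp: scalar_prod_def atLeast0LessThan)

lemma enum_change_inverse:
  assumes xs: "distinct xs" and ys: "distinct ys" and eq: "set xs = set ys"
    and n: "length xs = n" "length ys = n"
  shows "Matrix.mat n n (\<lambda>(i, j). if xs ! i = ys ! j then 1 else (0 :: 'b :: comm_ring_1))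
           * Matrix.mat n n (\<lambda>(i, j). if ys ! i = xs ! j then 1 else 0) = 1\<^sub>m n"
    (is "?P * ?Q = _")
proof -
  let ?\<delta> = "\<lambda>x y. if x = y then 1 else (0 :: 'b)"
  have "?P * ?Q = Matrix.mat n n (\<lambda>(i, j). \<Sum>z\<in>set ys. ?\<delta> (xs ! i) z * ?\<delta> z (xs ! j))"
    using fmat_mult[of ys xs ?\<delta> ?\<delta> xs] ys n by simp
  also have "\<dots> = 1\<^sub>m n"
  proof (rule eq_matI)
    fix i j assume "i < dim_row (1\<^sub>m n :: 'b Matrix.mat)" "j < dim_col (1\<^sub>m n :: 'b Matrix.mat)"
    then have ij: "i < n" "j < n" by auto
    have "(\<Sum>z\<in>set ys. ?\<delta> (xs ! i) z * ?\<delta> z (xs ! j)) = (\<Sum>z\<in>set ys. if z = xs ! i then ?\<delta> (xs ! i) (xs ! j) else 0)"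
      by (intro sum.cong) auto
    also have "\<dots> = ?\<delta> (xs ! i) (xs ! j)"
      using ij n eq nth_mem[of i xs] by simp
    also have "\<dots> = (if i = j then 1 else 0)"
      using ij n xs by (simp add: nth_eq_iff_index_eq)
    finally show "Matrix.mat n n (\<lambda>(i, j). \<Sum>z\<in>set ys. ?\<delta> (xs ! i) z * ?\<delta> z (xs ! j)) $$ (i, j)
        = 1\<^sub>m n $$ (i, j)"
      using ij by simp
  qed auto
  finally show ?thesis .
qed

text \<open>Two enumerations of a set differ by a permutation matrix acting on rows and columns at
  once, so the two matrices are similar.\<close>

lemma det_fmat_enum:
  fixes f :: "'a \<Rightarrow> 'a \<Rightarrow> 'b :: idom"
  assumes xs: "distinct xs" and ys: "distinct ys" and eq: "set xs = set ys"
  shows "Determinant.det (fmat xs f) = Determinant.det (fmat ys f)"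
proof -
  let ?n = "length xs"
  have len: "length ys = ?n" using distinct_card[OF xs] distinct_card[OF ys] unfolding eq by simp
  let ?\<delta> = "\<lambda>x y. if x = y then 1 else (0 :: 'b)"
  let ?P = "Matrix.mat ?n ?n (\<lambda>(i, j). ?\<delta> (xs ! i) (ys ! j))"
  let ?Q = "Matrix.mat ?n ?n (\<lambda>(i, j). ?\<delta> (ys ! i) (xs ! j))"
  have in_ys: "xs ! i \<in> set ys" if "i < ?n" for i using nth_mem[OF that] unfolding eq .
  have PQ: "?P * ?Q = 1\<^sub>m ?n" by (rule enum_change_inverse[OF xs ys eq refl len])
  have QP: "?Q * ?P = 1\<^sub>m ?n" by (rule enum_change_inverse[OF ys xs eq[symmetric] len refl])
  have sum1: "(\<Sum>z\<in>set ys. ?\<delta> (xs ! i) z * h z) = h (xs ! i)" if "i < ?n" for h i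
  proof -
    have "(\<Sum>z\<in>set ys. ?\<delta> (xs ! i) z * h z) = (\<Sum>z\<in>set ys. if z = xs ! i then h (xs ! i) else 0)"
      by (intro sum.cong) auto
    then show ?thesis using in_ys[OF that] by simp
  qed
  have sum2: "(\<Sum>z\<in>set ys. h z * ?\<delta> z (xs ! i)) = h (xs ! i)" if "i < ?n" for h i
  proof -
    have "(\<Sum>z\<in>set ys. h z * ?\<delta> z (xs ! i)) = (\<Sum>z\<in>set ys. if z = xs ! i then h (xs ! i) else 0)"
      by (intro sum.cong) auto
    then show ?thesis using in_ys[OF that] by simp
  qed
  have PB: "?P * fmat ys f = Matrix.mat ?n ?n (\<lambda>(i, j). f (xs ! i) (ys ! j))"
    using fmat_mult[OF ys len, of ?\<delta> f ys] sum1 by (auto simp: fmat_def len intro!: cong_mat)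
  have "?P * fmat ys f * ?Q = fmat xs f"
    unfolding PB using fmat_mult[OF ys len, of f ?\<delta> xs] sum2 by (auto simp: fmat_def intro!: cong_mat)
  then have "similar_mat_wit (fmat xs f) (fmat ys f) ?P ?Q"
    using PQ QP len by (auto simp: similar_mat_wit_def Let_def fmat_def)
  then show ?thesis using det_similar unfolding similar_mat_def by blast
qed

lemma fdet_eq:
  assumes "distinct xs" "set xs = V"
  shows "fdet V f = Determinant.det (fmat xs f)"
  using det_fmat_enum[of "enum_of V" xs f] enum_of[of V] assms by (auto simp: fdet_def)

lemma fdet_cong:
  assumes "finite V" "\<And>x y. x \<in> V \<Longrightarrow> y \<in> V \<Longrightarrow> f x y = g x y"
  shows "fdet V f = fdet V g"
  unfolding fdet_def using enum_of[OF assms(1)] assms(2) by (auto intro!: arg_cong[of _ _ Determinant.det] fmat_cong)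

lemma fdet_image:
  assumes "finite V" "inj_on h V"
  shows "fdet (h ` V) f = fdet V (\<lambda>x y. f (h x) (h y))"
proof -
  note e = enum_of[OF assms(1)]
  have "fdet (h ` V) f = Determinant.det (fmat (map h (enum_of V)) f)"
    using e assms(2) by (intro fdet_eq) (auto simp: distinct_map)
  also have "fmat (map h (enum_of V)) f = fmat (enum_of V) (\<lambda>x y. f (h x) (h y))"
    unfolding fmat_def length_map by (intro cong_mat) auto
  finally show ?thesis by (simp add: fdet_def)
qed

lemma fdet_mult:
  assumes "finite V"
  shows "fdet V (\<lambda>x y. \<Sum>z\<in>V. f x z * g z y) = fdet V f * fdet V g"
  using enum_of[OF assms]
  by (simp add: fdet_def fmat_def det_mult[symmetric, of _ "length (enum_of V)"] fmat_mult)

lemma fdet_smult: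
  assumes "finite V"
  shows "fdet V (\<lambda>x y. c * f x y) = c ^ card V * fdet V f"
proof -
  have "fmat (enum_of V) (\<lambda>x y. c * f x y) = c \<cdot>\<^sub>m fmat (enum_of V) f"
    by (intro eq_matI) (auto simp: fmat_def)
  moreover have "dim_col (fmat (enum_of V) f) = card V"
    using enum_of[OF assms] by (auto simp: fmat_def distinct_card[symmetric])
  ultimately show ?thesis by (simp add: fdet_def)
qed

lemma fdet_id:
  assumes "finite V"
  shows "fdet V (\<lambda>x y. if x = y then 1 else 0) = (1 :: 'b :: idom)"
proof -
  have "fmat (enum_of V) (\<lambda>x y. if x = y then 1 else (0 :: 'b)) = 1\<^sub>m (length (enum_of V))"
    using enum_of[OF assms] by (intro eq_matI) (auto simp: fmat_def nth_eq_iff_index_eq)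
  then show ?thesis by (simp add: fdet_def)
qed

lemma fdet_scalar:
  assumes "finite V"
  shows "fdet V (\<lambda>x y. if x = y then c else 0) = (c :: 'b :: idom) ^ card V"
  using fdet_smult[OF assms, of c "\<lambda>x y. if x = y then 1 else 0"] fdet_id[OF assms, where 'b = 'b]
  by (simp add: if_distrib cong: if_cong)

text \<open>Enumerating \<open>A\<close> before \<open>B\<close> makes the matrix block triangular,
  upper or lower according to which mixed block vanishes.\<close>

lemma fdet_block:
  assumes "finite A" "finite B" "A \<inter> B = {}"
    and "(\<forall>x\<in>A. \<forall>y\<in>B. f x y = 0) \<or> (\<forall>x\<in>B. \<forall>y\<in>A. f x y = 0)"
  shows "fdet (A \<union> B) f = fdet A f * fdet B f"
proof -
  let ?a = "enum_of A" and ?b = "enum_of B"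
  note ea = enum_of[OF assms(1)] and eb = enum_of[OF assms(2)]
  let ?n = "length ?a" and ?m = "length ?b"
  define U where "U = Matrix.mat ?n ?m (\<lambda>(i, j). f (?a ! i) (?b ! j))"
  define L where "L = Matrix.mat ?m ?n (\<lambda>(i, j). f (?b ! i) (?a ! j))"
  have "fdet (A \<union> B) f = Determinant.det (fmat (?a @ ?b) f)"
    using ea eb assms(3) by (intro fdet_eq) auto
  also have "fmat (?a @ ?b) f = four_block_mat (fmat ?a f) U L (fmat ?b f)"
    by (intro eq_matI) (auto simp: fmat_def U_def L_def nth_append)
  also have "Determinant.det \<dots> = Determinant.det (fmat ?a f) * Determinant.det (fmat ?b f)"
    using assms(4)
  proof
    assume "\<forall>x\<in>A. \<forall>y\<in>B. f x y = 0"
    then have "U = 0\<^sub>m ?n ?m" using ea eb nth_mem[of _ ?a] nth_mem[of _ ?b]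
      unfolding U_def by (intro eq_matI) auto
    then show ?thesis
      by (intro det_four_block_mat_upper_right_zero) (auto simp: L_def)
  next
    assume "\<forall>x\<in>B. \<forall>y\<in>A. f x y = 0"
    then have "L = 0\<^sub>m ?m ?n" using ea eb nth_mem[of _ ?a] nth_mem[of _ ?b]
      unfolding L_def by (intro eq_matI) auto
    then show ?thesis
      by (intro det_four_block_mat_lower_left_zero) (auto simp: U_def)
  qed
  finally show ?thesis by (simp add: fdet_def)
qed

lemma fdet_UN:
  assumes "finite I" "\<And>i. i \<in> I \<Longrightarrow> finite (A i)"
    and "\<And>i j. i \<in> I \<Longrightarrow> j \<in> I \<Longrightarrow> i \<noteq> j \<Longrightarrow> A i \<inter> A j = {}"
    and "\<And>i j x y. i \<in> I \<Longrightarrow> j \<in> I \<Longrightarrow> i \<noteq> j \<Longrightarrow> x \<in> A i \<Longrightarrow> y \<in> A j \<Longrightarrow> f x y = 0"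
  shows "fdet (\<Union>i\<in>I. A i) f = (\<Prod>i\<in>I. fdet (A i) f)"
  using assms
proof (induction I rule: finite_induct)
  case empty
  then show ?case using fdet_cong[of "{}" f "\<lambda>x y. if x = y then 1 else 0"] fdet_id[of "{}"] by simp
next
  case (insert i I)
  have "fdet (A i \<union> (\<Union>i\<in>I. A i)) f = fdet (A i) f * fdet (\<Union>i\<in>I. A i) f"
  proof (rule fdet_block)
    show "A i \<inter> (\<Union>i\<in>I. A i) = {}" using insert.prems(2)[of i] insert.hyps by blast
    show "(\<forall>x\<in>A i. \<forall>y\<in>(\<Union>i\<in>I. A i). f x y = 0) \<or> (\<forall>x\<in>(\<Union>i\<in>I. A i). \<forall>y\<in>A i. f x y = 0)"
      using insert.prems(3)[of i] insert.hyps by blast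
  qed (use insert in auto)
  moreover have "fdet (\<Union>i\<in>I. A i) f = (\<Prod>i\<in>I. fdet (A i) f)"
  proof (rule insert.IH)
    fix j k x y assume "j \<in> I" "k \<in> I" "j \<noteq> k" "x \<in> A j" "y \<in> A k"
    then show "f x y = 0" using insert.prems(3)[of j k x y] by simp
  qed (use insert.prems in auto)
  ultimately show ?case using insert.hyps by simp
qed

lemma fdet_3:
  assumes "distinct [a, b, c]"
  shows "fdet {a, b, c} f = f a a * (f b b * f c c - f b c * f c b)
    - f a b * (f b a * f c c - f b c * f c a) + f a c * (f b a * f c b - f b b * f c a)"
proof -
  have "fdet {a, b, c} f = Determinant.det (fmat [a, b, c] f)"
    using assms by (intro fdet_eq) auto
  also have "\<dots> = f a a * (f b b * f c c - f b c * f c b)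
    - f a b * (f b a * f c c - f b c * f c a) + f a c * (f b a * f c b - f b b * f c a)"
    apply (subst laplace_expansion_column[of _ 3 0])
      apply (simp_all add: fmat_def numeral_3_eq_3)
    apply (simp add: cofactor_def mat_delete_def)
    apply (subst laplace_expansion_column[of _ "Suc (Suc 0)" 0], simp, simp)+
    apply (simp add: cofactor_def mat_delete_def det_single algebra_simps numeral_2_eq_2)
    done
  finally show ?thesis .
qed

text \<open>This is the bridge from characteristic polynomials to determinants over index sets;
  polynomial identities are later checked pointwise in \<open>k\<close>.\<close>

lemma poly_char_poly_fmat:
  fixes f :: "'a \<Rightarrow> 'a \<Rightarrow> complex"
  assumes "distinct xs"
  shows "poly (char_poly (fmat xs f)) k = fdet (set xs) (\<lambda>x y. (if x = y then k else 0) - f x y)"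
proof -
  have "- (char_matrix (fmat xs f) k) = fmat xs (\<lambda>x y. (if x = y then k else 0) - f x y)"
    using assms by (intro eq_matI) (auto simp: char_matrix_def fmat_def nth_eq_iff_index_eq)
  then show ?thesis
    by (simp add: char_poly_matrix[OF fmat_carrier] fdet_eq[OF assms refl])
qed

section \<open>Cells of the Sierpinski graphs\<close>

text \<open>The pair \<open>(m, n)\<close> stands for the lattice point \<open>m + n omega0\<close>. A cell is an upward unit triangle,
  given by its lower left corner \<open>p\<close>; \<open>mid p\<close> are the midpoints of the sides of the doubled cell.\<close>
definition tri :: "int \<times> int \<Rightarrow> (int \<times> int) set" where
  "tri p = {p, (fst p + 1, snd p), (fst p, snd p + 1)}"

definition mid :: "int \<times> int \<Rightarrow> (int \<times> int) set" where
  "mid p = {(2 * fst p + 1, 2 * snd p), (2 * fst p, 2 * snd p + 1), (2 * fst p + 1, 2 * snd p + 1)}"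

definition dbl :: "int \<times> int \<Rightarrow> int \<times> int" where
  "dbl p = (2 * fst p, 2 * snd p)"

text \<open>The set \<open>tri (dbl p)\<close> is used here as a set of cells: its three points are
  the lower left corners of the upward unit triangles in the doubled cell.\<close>

fun cells :: "nat \<Rightarrow> (int \<times> int) set" where
  "cells 0 = {(0, 0)}"
| "cells (Suc n) = (\<Union>p\<in>cells n. tri (dbl p))"

definition vert :: "nat \<Rightarrow> (int \<times> int) set" where
  "vert n = (\<Union>p\<in>cells n. tri p)"

definition mids :: "nat \<Rightarrow> (int \<times> int) set" where
  "mids n = (\<Union>p\<in>cells n. mid p)"

definition adj :: "nat \<Rightarrow> int \<times> int \<Rightarrow> int \<times> int \<Rightarrow> bool" where
  "adj n x y \<longleftrightarrow> x \<noteq> y \<and> (\<exists>p\<in>cells n. x \<in> tri p \<and> y \<in> tri p)"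

text \<open>Each cell through \<open>x\<close> contributes its two other corners, and no neighbour
  is counted twice; \<open>card_adj\<close> confirms that this is the graph degree.\<close>

definition deg :: "nat \<Rightarrow> int \<times> int \<Rightarrow> nat" where
  "deg n x = 2 * card {p \<in> cells n. x \<in> tri p}"

text \<open>With \<open>t = \<lambda> - 1\<close> these are the entries of \<open>\<lambda> - L\<close>, where \<open>L\<close> is the magnetic Laplacian.\<close>
definition lap_mat :: "nat \<Rightarrow> (int \<times> int \<Rightarrow> int \<times> int \<Rightarrow> complex) \<Rightarrow> complex \<Rightarrow> int \<times> int \<Rightarrow> int \<times> int \<Rightarrow> complex" where
  "lap_mat n W t x y = (if x = y then t else if adj n x y then W x y / of_nat (deg n x) else 0)"

section \<open>Incidence, adjacency and counting for cells and midpoints\<close>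

lemma finite_cells [simp]: "finite (cells n)"
  by (induction n) (auto simp: tri_def)

lemma finite_vert [simp]: "finite (vert n)"
  by (auto simp: vert_def tri_def)

lemma finite_tri [simp]: "finite (tri p)"
  by (simp add: tri_def)

lemma finite_mid [simp]: "finite (mid p)"
  by (simp add: mid_def)

lemma finite_mids [simp]: "finite (mids n)"
  by (auto simp: mids_def)

lemma inj_dbl: "inj_on dbl A"
  by (auto simp: inj_on_def dbl_def prod_eq_iff)

lemma dbl_eq_iff [simp]: "dbl x = dbl y \<longleftrightarrow> x = y"
  by (auto simp: dbl_def prod_eq_iff)

lemma adj_sym: "adj n x y \<longleftrightarrow> adj n y x"
  by (auto simp: adj_def)

text \<open>Halving the coordinates of a midpoint and rounding down recovers its cell.\<close>

lemma mid_disjoint: "m \<in> mid p \<Longrightarrow> m \<in> mid q \<Longrightarrow> p = q"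
  by (cases p; cases q; cases m) (auto simp: mid_def; presburger)

lemma dbl_notin_mid [simp]: "dbl x \<notin> mid p"
  by (cases x; cases p) (auto simp: mid_def dbl_def; presburger)

lemma dbl_notin_mids [simp]: "dbl x \<notin> mids n"
  by (simp add: mids_def dbl_notin_mid)

lemma tri_dbl_disjoint: "m \<in> tri (dbl p) \<Longrightarrow> m \<in> tri (dbl q) \<Longrightarrow> p = q"
  by (cases p; cases q; cases m) (auto simp: tri_def dbl_def; presburger)

text \<open>Every edge of the triangular lattice is a side of exactly one upward triangle.\<close>

lemma tri_two_points: "x \<in> tri p \<Longrightarrow> y \<in> tri p \<Longrightarrow> x \<in> tri q \<Longrightarrow> y \<in> tri q \<Longrightarrow> x \<noteq> y \<Longrightarrow> p = q"
  by (cases p; cases q; cases x; cases y) (auto simp: tri_def)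

lemma card_cells: "card (cells n) = 3 ^ n"
proof (induction n)
  case (Suc n)
  have "card (\<Union>p\<in>cells n. tri (dbl p)) = (\<Sum>p\<in>cells n. card (tri (dbl p)))"
    by (intro card_UN_disjoint) (use tri_dbl_disjoint in auto)
  also have "\<dots> = (\<Sum>p\<in>cells n. 3)"
    by (intro sum.cong) (auto simp: tri_def prod_eq_iff card_insert_if)
  finally show ?case using Suc by simp
qed simp

lemma card_mids: "card (mids n) = 3 ^ Suc n"
proof -
  have "card (\<Union>p\<in>cells n. mid p) = (\<Sum>p\<in>cells n. card (mid p))"
    by (intro card_UN_disjoint) (use mid_disjoint in auto)
  also have "\<dots> = (\<Sum>p\<in>cells n. 3)"
    by (intro sum.cong) (auto simp: mid_def prod_eq_iff card_insert_if)
  finally show ?thesis by (simp add: mids_def card_cells)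
qed

lemma tri_subdivision: "(\<Union>q\<in>tri (dbl p). tri q) = dbl ` tri p \<union> mid p"
  by (cases p) (auto simp: tri_def mid_def dbl_def)

lemma vert_Suc: "vert (Suc n) = dbl ` vert n \<union> mids n"
proof -
  have "vert (Suc n) = (\<Union>p\<in>cells n. \<Union>q\<in>tri (dbl p). tri q)" by (auto simp: vert_def)
  then show ?thesis unfolding tri_subdivision by (auto simp: vert_def mids_def)
qed

lemma card_vert: "card (vert n) = (3 ^ (n + 1) + 3) div 2"
proof -
  have "2 * card (vert n) = 3 ^ (n + 1) + 3"
  proof (induction n)
    case 0
    then show ?case by (simp add: vert_def tri_def)
  next
    case (Suc n)
    have "card (vert (Suc n)) = card (dbl ` vert n) + card (mids n)"
      unfolding vert_Suc by (rule card_Un_disjoint) (use dbl_notin_mids in auto)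
    then show ?case using Suc by (simp add: card_mids card_image inj_dbl)
  qed
  then show ?thesis by simp
qed

lemma cell_of_mid:
  assumes "q \<in> tri (dbl r)" "m \<in> tri q" "m \<in> mid p"
  shows "r = p"
proof -
  have "m \<in> dbl ` tri r \<union> mid r" using assms(1,2) tri_subdivision by blast
  then show ?thesis using assms(3) mid_disjoint dbl_notin_mid by blast
qed

text \<open>A midpoint lies only in subcells of its own doubled cell. This makes the elimination
  local.\<close>

lemma adj_mid:
  assumes "p \<in> cells n" "m \<in> mid p"
  shows "adj (Suc n) m y \<longleftrightarrow> m \<noteq> y \<and> (\<exists>q\<in>tri (dbl p). m \<in> tri q \<and> y \<in> tri q)"
  using assms by (auto simp: adj_def dest: cell_of_mid)

lemma adj_mid_explicit:
  assumes "(a, b) \<in> cells n"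
  shows "adj (Suc n) (2*a+1, 2*b) y \<longleftrightarrow> y \<in> {(2*a, 2*b), (2*a+2, 2*b), (2*a, 2*b+1), (2*a+1, 2*b+1)}"
    and "adj (Suc n) (2*a, 2*b+1) y \<longleftrightarrow> y \<in> {(2*a, 2*b), (2*a, 2*b+2), (2*a+1, 2*b), (2*a+1, 2*b+1)}"
    and "adj (Suc n) (2*a+1, 2*b+1) y \<longleftrightarrow> y \<in> {(2*a+2, 2*b), (2*a, 2*b+2), (2*a+1, 2*b), (2*a, 2*b+1)}"
    using assms by (auto simp: adj_mid[OF assms] mid_def tri_def dbl_def)

text \<open>Adjacent points differ by an odd amount in some coordinate, whereas doubled points have
  even coordinates.\<close>

lemma not_adj_dbl: "\<not> adj (Suc n) (dbl x) (dbl y)"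
  by (cases x; cases y) (auto simp: adj_def tri_def dbl_def; presburger)

lemma deg_mid:
  assumes "p \<in> cells n" "m \<in> mid p"
  shows "deg (Suc n) m = 4"
proof -
  have "{q \<in> cells (Suc n). m \<in> tri q} = {q \<in> tri (dbl p). m \<in> tri q}"
    using assms by (auto dest: cell_of_mid)
  also have "card \<dots> = 2"
  proof -
    obtain a b where p: "p = (a, b)" by (cases p)
    consider "m = (2*a+1, 2*b)" | "m = (2*a, 2*b+1)" | "m = (2*a+1, 2*b+1)"
      using assms p by (auto simp: mid_def)
    then show ?thesis
    proof cases
      case 1
      then have "{q \<in> tri (dbl p). m \<in> tri q} = {(2*a, 2*b), (2*a+1, 2*b)}"
        by (auto simp: tri_def dbl_def p)
      then show ?thesis by simp
    next
      case 2
      then have "{q \<in> tri (dbl p). m \<in> tri q} = {(2*a, 2*b), (2*a, 2*b+1)}"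
        by (auto simp: tri_def dbl_def p)
      then show ?thesis by simp
    next
      case 3
      then have "{q \<in> tri (dbl p). m \<in> tri q} = {(2*a+1, 2*b), (2*a, 2*b+1)}"
        by (auto simp: tri_def dbl_def p)
      then show ?thesis by simp
    qed
  qed
  finally show ?thesis by (simp add: deg_def)
qed

lemma deg_dbl: "deg (Suc n) (dbl x) = deg n x"
proof -
  \<comment> \<open>In a cell \<open>r\<close> with corner \<open>x\<close>, the subcell containing
    \<open>dbl x\<close> is \<open>dbl r\<close> moved by the offset \<open>x - r\<close>, that is,
    \<open>r + x\<close>.\<close>
  have "{q \<in> cells (Suc n). dbl x \<in> tri q} = (\<lambda>r. (fst r + fst x, snd r + snd x)) ` {r \<in> cells n. x \<in> tri r}"
    (is "?L = ?h ` ?R")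
  proof (intro equalityI subsetI)
    fix q assume "q \<in> ?L"
    then obtain r where r: "r \<in> cells n" "q \<in> tri (dbl r)" "dbl x \<in> tri q" by auto
    then have "x \<in> tri r \<and> q = ?h r"
      by (cases x; cases r; cases q) (auto simp: tri_def dbl_def; presburger)
    then show "q \<in> ?h ` ?R" using r by blast
  next
    fix q assume "q \<in> ?h ` ?R"
    then obtain r where r: "r \<in> cells n" "x \<in> tri r" "q = ?h r" by auto
    then have "q \<in> tri (dbl r) \<and> dbl x \<in> tri q"
      by (cases x; cases r; cases q) (auto simp: tri_def dbl_def)
    then show "q \<in> ?L" using r by auto
  qed
  moreover have "inj_on ?h ?R" by (auto simp: inj_on_def prod_eq_iff)
  ultimately show ?thesis by (simp add: deg_def card_image)
qed

lemma deg_pos: "x \<in> vert n \<Longrightarrow> deg n x > 0"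
  by (auto simp: vert_def deg_def card_gt_0_iff)

section \<open>Elimination inside a cell\<close>

text \<open>Unitarity enters as mutual inverseness of the two orientations of each side, which makes
  the computations below pure algebra.\<close>

definition hol :: "('a \<Rightarrow> 'a \<Rightarrow> complex) \<Rightarrow> complex \<Rightarrow> 'a \<Rightarrow> 'a \<Rightarrow> 'a \<Rightarrow> bool" where
  "hol W e x y z \<longleftrightarrow> W x y * W y x = 1 \<and> W y z * W z y = 1 \<and> W x z * W z x = 1
     \<and> W x y * W y z * W z x = e"

lemma hol_rotate: "hol W e x y z \<Longrightarrow> hol W e y z x"
  by (simp add: hol_def ac_simps)

text \<open>Reversing the loop inverts its holonomy, and \<open>e\<close> is its own
  inverse.\<close>

lemma hol_flip:
  assumes "hol W e x y z" "e * e = 1"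
  shows "hol W e x z y"
proof -
  have "W x y * W y x = 1" "W y z * W z y = 1" "W x z * W z x = 1" "W x y * W y z * W z x = e"
    using assms by (simp_all add: hol_def)
  note h = this
  have "(W x y * W y z * W z x) * (W x z * W z y * W y x) = (W x y * W y x) * (W y z * W z y) * (W x z * W z x)"
    by (simp only: ac_simps)
  then have "e * (W x z * W z y * W y x) = 1" unfolding h by simp
  then have "e * e * (W x z * W z y * W y x) = e" by (simp only: mult.assoc mult_1_right)
  then have "W x z * W z y * W y x = e" unfolding assms(2) by simp
  then show ?thesis using h by (simp add: hol_def ac_simps)
qed

lemma hol_path:
  assumes "hol W e x y z"
  shows "W x y * W y z = e * W x z"
proof -
  have "W x z * W z x = 1" "W x y * W y z * W z x = e"
    using assms by (simp_all add: hol_def)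
  note h = this
  have "W x y * W y z = W x y * W y z * (W x z * W z x)" unfolding h by simp
  also have "\<dots> = W x y * W y z * W z x * W x z" by (simp only: ac_simps)
  finally show ?thesis unfolding h .
qed

text \<open>Here \<open>c\<close> is a corner of a doubled cell, \<open>m1\<close> and
  \<open>m2\<close> are the midpoints next to it, \<open>m0\<close> is the opposite midpoint, and
  \<open>cj\<close>, \<open>ck\<close> are the other corners. The conclusions evaluate the weighted
  sum of the midpoint rows in the columns \<open>m1\<close>, \<open>m2\<close>, \<open>m0\<close>,
  \<open>c\<close>, \<open>cj\<close>, \<open>ck\<close>, the last three up to constant
  factors.\<close>

lemma hexagon_identities:
  assumes h1: "hol W e c m1 m2" and h2: "hol W e cj m1 m0" and h3: "hol W e ck m2 m0" and h0: "hol W f m0 m1 m2"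
    and ee: "e * e = 1" and ff: "f * f = 1"
    and \<delta>: "\<delta> = A * t + A * e / 4 + B / 4" and AB: "A * (1 + e * f) / 4 + B * t = 0" and B: "B * e * f = B"
  shows "A * W c m1 * t + A * W c m2 * W m2 m1 / 4 + B * W c m1 * W m1 m0 * W m0 m1 / 4 = \<delta> * W c m1"
    and "A * W c m1 * W m1 m2 / 4 + A * W c m2 * t + B * W c m1 * W m1 m0 * W m0 m2 / 4 = \<delta> * W c m2"
    and "A * W c m1 * W m1 m0 / 4 + A * W c m2 * W m2 m0 / 4 + B * W c m1 * W m1 m0 * t = 0"
    and "A * (W c m1 * W m1 c) / 2 + A * (W c m2 * W m2 c) / 2 = A"
    and "A * W c m1 * W m1 cj + B * W c m1 * W m1 m0 * W m0 cj = (A + B * e) * (W c m1 * W m1 cj)"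
    and "A * W c m2 * W m2 ck + B * W c m1 * W m1 m0 * W m0 ck = (A + B * e) * (W c m2 * W m2 ck)"
proof -
  have p1: "W c m2 * W m2 m1 = e * W c m1" "W c m1 * W m1 m2 = e * W c m2"
    using hol_path[OF h1] hol_path[OF hol_flip[OF h1 ee]] by auto
  have i0: "W m1 m0 * W m0 m1 = 1" "W m2 m0 * W m0 m2 = 1" "W m1 m2 * W m2 m1 = 1"
    using h0 by (simp_all add: hol_def ac_simps)
  have ic: "W c m1 * W m1 c = 1" "W c m2 * W m2 c = 1"
    using h1 by (simp_all add: hol_def)
  have p0: "W m1 m0 * W m0 m2 = f * W m1 m2" "W m1 m2 * W m2 m0 = f * W m1 m0"
    using hol_path[OF hol_flip[OF hol_rotate[OF h0] ff]] hol_path[OF hol_rotate[OF h0]] by auto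
  have pj: "W m1 m0 * W m0 cj = e * W m1 cj"
    using hol_path[OF hol_rotate[OF h2]] .
  have pk: "W m2 m0 * W m0 ck = e * W m2 ck"
    using hol_path[OF hol_rotate[OF h3]] .
  \<comment> \<open>The two routes from \<open>c\<close> to \<open>m0\<close> enclose one corner
    triangle and the inner triangle, whence the factor \<open>e * f\<close>.\<close>
  have q2: "W c m2 * W m2 m0 = e * f * (W c m1 * W m1 m0)"
  proof -
    have "W c m2 * W m2 m0 = e * e * W c m2 * W m2 m0" using ee by simp
    also have "\<dots> = e * (W c m1 * W m1 m2) * W m2 m0" unfolding p1(2) by simp
    also have "\<dots> = e * W c m1 * (W m1 m2 * W m2 m0)" by simp
    also have "\<dots> = e * f * (W c m1 * W m1 m0)" unfolding p0(2) by (simp only: ac_simps)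
    finally show ?thesis .
  qed
  \<comment> \<open>After multiplication by \<open>B\<close> the two routes agree, so each identity
    below may use the more convenient one.\<close>
  have "B * W c m2 * W m2 m0 = (B * e * f) * (W c m1 * W m1 m0)"
    using q2 by (simp add: mult.assoc)
  then have q1: "B * W c m1 * W m1 m0 = B * W c m2 * W m2 m0"
    unfolding B by (simp only: mult.assoc)
  have "A * W c m1 * t + A * (W c m2 * W m2 m1) / 4 + B * W c m1 * (W m1 m0 * W m0 m1) / 4 = \<delta> * W c m1"
    unfolding p1 i0 \<delta> by (simp add: field_simps)
  then show "A * W c m1 * t + A * W c m2 * W m2 m1 / 4 + B * W c m1 * W m1 m0 * W m0 m1 / 4 = \<delta> * W c m1"
    by (simp only: mult.assoc)
  have "A * (W c m1 * W m1 m2) / 4 + A * W c m2 * t + B * W c m2 * (W m2 m0 * W m0 m2) / 4 = \<delta> * W c m2"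
    unfolding p1 i0 \<delta> by (simp add: field_simps)
  then show "A * W c m1 * W m1 m2 / 4 + A * W c m2 * t + B * W c m1 * W m1 m0 * W m0 m2 / 4 = \<delta> * W c m2"
    unfolding q1 by (simp only: mult.assoc)
  have "A * (W c m1 * W m1 m0) / 4 + A * (W c m2 * W m2 m0) / 4 + B * (W c m1 * W m1 m0) * t
      = (A * (1 + e * f) / 4 + B * t) * (W c m1 * W m1 m0)"
    unfolding q2 by (simp add: field_simps)
  then show "A * W c m1 * W m1 m0 / 4 + A * W c m2 * W m2 m0 / 4 + B * W c m1 * W m1 m0 * t = 0"
    unfolding AB by (simp add: mult.assoc)
  show "A * (W c m1 * W m1 c) / 2 + A * (W c m2 * W m2 c) / 2 = A"
    unfolding ic by simp
  have "A * W c m1 * W m1 cj + B * W c m1 * (W m1 m0 * W m0 cj) = (A + B * e) * (W c m1 * W m1 cj)"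
    unfolding pj by (simp add: field_simps)
  then show "A * W c m1 * W m1 cj + B * W c m1 * W m1 m0 * W m0 cj = (A + B * e) * (W c m1 * W m1 cj)"
    by (simp only: mult.assoc)
  have "A * W c m2 * W m2 ck + B * W c m2 * (W m2 m0 * W m0 ck) = (A + B * e) * (W c m2 * W m2 ck)"
    unfolding pk by (simp add: field_simps)
  then show "A * W c m2 * W m2 ck + B * W c m1 * W m1 m0 * W m0 ck = (A + B * e) * (W c m2 * W m2 ck)"
    unfolding q1 by (simp only: mult.assoc)
qed

definition has_flux :: "complex \<Rightarrow> complex \<Rightarrow> (int \<times> int \<Rightarrow> int \<times> int \<Rightarrow> complex) \<Rightarrow> bool" where
  "has_flux e f W \<longleftrightarrow> (\<forall>a b. hol W e (a, b) (a+1, b) (a, b+1) \<and> hol W f (a+1, b) (a+1, b+1) (a, b+1))"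

text \<open>Parallel transport in \<open>W\<close> along the side of a doubled cell.\<close>
definition renorm :: "(int \<times> int \<Rightarrow> int \<times> int \<Rightarrow> complex) \<Rightarrow> int \<times> int \<Rightarrow> int \<times> int \<Rightarrow> complex" where
  "renorm W x y = W (dbl x) (fst x + fst y, snd x + snd y) * W (fst x + fst y, snd x + snd y) (dbl y)"

text \<open>Row operations adding multiples of the midpoint rows to a corner row \<open>c\<close>, scaled by \<open>\<delta>\<close>, clear the
  midpoint columns if the midpoint \<open>m\<close> is weighted by \<open>A\<close> times the parallel transport from \<open>c\<close> when
  \<open>m\<close> is adjacent to \<open>c\<close>, and by \<open>B\<close> times it when \<open>m\<close> is opposite to \<open>c\<close>. The conditions \<open>\<delta>\<close> and \<open>AB\<close>
  express this; by \<open>B\<close> the two transports to the opposite midpoint may differ (\<open>e f = -1\<close>) only if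
  the weight \<open>B\<close> vanishes.\<close>
locale decimation =
  fixes W :: "int \<times> int \<Rightarrow> int \<times> int \<Rightarrow> complex" and e f t A B \<delta> \<psi> \<tau> :: complex
  assumes flux: "has_flux e f W" and ee: "e * e = 1" and ff: "f * f = 1"
    and \<delta>: "\<delta> = A * t + A * e / 4 + B / 4" and AB: "A * (1 + e * f) / 4 + B * t = 0" and B: "B * e * f = B"
    and \<psi>: "\<psi> = - ((A + B * e) / 4)" and \<tau>: "\<delta> * t - A / 4 = \<psi> * \<tau>"
begin

text \<open>The weight is read off from the displacement, so it needs no reference to a cell. The
  six unit displacements lead to adjacent midpoints; \<open>(1,1)\<close>, \<open>(-2,1)\<close>,
  \<open>(1,-2)\<close> lead from the lower left, lower right and top corner to the opposite
  midpoint, each through one fixed intermediate midpoint.\<close>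

definition path_weight :: "int \<times> int \<Rightarrow> int \<times> int \<Rightarrow> complex" where
  "path_weight u m = (let d = (fst m - fst u, snd m - snd u) in
     if d \<in> {(1,0), (0,1), (-1,0), (0,-1), (1,-1), (-1,1)} then A * W u m
     else if d = (1,1) then B * W u (fst u + 1, snd u) * W (fst u + 1, snd u) m
     else if d = (-2,1) then B * W u (fst m + 1, snd u) * W (fst m + 1, snd u) m
     else if d = (1,-2) then B * W u (fst u, snd m + 1) * W (fst u, snd m + 1) m
     else 0)"

definition cell_sum :: "nat \<Rightarrow> int \<times> int \<Rightarrow> int \<times> int \<Rightarrow> int \<times> int \<Rightarrow> complex" where
  "cell_sum n p u y = (\<Sum>m\<in>mid p. path_weight u m * lap_mat (Suc n) W t m y)"

text \<open>Halving a displacement and rounding down gives \<open>p - x\<close>. For the nine listed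
  displacements this is \<open>(0,0)\<close>, \<open>(-1,0)\<close> or \<open>(0,-1)\<close>, which
  would make \<open>x\<close> a corner of \<open>p\<close>.\<close>

lemma path_weight_0:
  assumes "m \<in> mid p" "x \<notin> tri p"
  shows "path_weight (dbl x) m = 0"
proof -
  obtain a b c d where px: "p = (a, b)" "x = (c, d)" by (metis surj_pair)
  have x: "\<not> (c = a \<and> d = b)" "\<not> (c = a + 1 \<and> d = b)" "\<not> (c = a \<and> d = b + 1)"
    using assms(2) by (auto simp: px tri_def)
  have "(fst m - fst (dbl x), snd m - snd (dbl x)) \<notin>
      {(1,0), (0,1), (-1,0), (0,-1), (1,-1), (-1,1), (1,1), (-2,1), (1,-2)}"
  proof -
    consider "m = (2*a+1, 2*b)" | "m = (2*a, 2*b+1)" | "m = (2*a+1, 2*b+1)"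
      using assms(1) by (auto simp: mid_def px)
    then show ?thesis
      by cases (simp_all add: px dbl_def, (use x in presburger)+)
  qed
  then show ?thesis
    unfolding path_weight_def Let_def
    by (simp only: insert_iff empty_iff de_Morgan_disj simp_thms if_False)
qed

lemma hol_cell:
  "hol W e (2*a, 2*b) (2*a+1, 2*b) (2*a, 2*b+1)"
  "hol W e (2*a+1, 2*b) (2*a+2, 2*b) (2*a+1, 2*b+1)"
  "hol W e (2*a, 2*b+1) (2*a+1, 2*b+1) (2*a, 2*b+2)"
  "hol W f (2*a+1, 2*b) (2*a+1, 2*b+1) (2*a, 2*b+1)"
proof -
  have 1: "hol W e (a, b) (a+1, b) (a, b+1)" for a b using flux by (simp add: has_flux_def)
  show "hol W e (2*a, 2*b) (2*a+1, 2*b) (2*a, 2*b+1)" by (rule 1)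
  show "hol W e (2*a+1, 2*b) (2*a+2, 2*b) (2*a+1, 2*b+1)" using 1[of "2*a+1" "2*b"] by (simp add: add.assoc)
  show "hol W e (2*a, 2*b+1) (2*a+1, 2*b+1) (2*a, 2*b+2)" using 1[of "2*a" "2*b+1"] by (simp add: add.assoc)
  show "hol W f (2*a+1, 2*b) (2*a+1, 2*b+1) (2*a, 2*b+1)" using flux by (simp add: has_flux_def)
qed

lemma lap_mat_mid:
  assumes "(a, b) \<in> cells n"
  shows "lap_mat (Suc n) W t (2*a+1, 2*b) y = (if y = (2*a+1, 2*b) then t else
      if y \<in> {(2*a, 2*b), (2*a+2, 2*b), (2*a, 2*b+1), (2*a+1, 2*b+1)} then W (2*a+1, 2*b) y / 4 else 0)"
    and "lap_mat (Suc n) W t (2*a, 2*b+1) y = (if y = (2*a, 2*b+1) then t else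
      if y \<in> {(2*a, 2*b), (2*a, 2*b+2), (2*a+1, 2*b), (2*a+1, 2*b+1)} then W (2*a, 2*b+1) y / 4 else 0)"
    and "lap_mat (Suc n) W t (2*a+1, 2*b+1) y = (if y = (2*a+1, 2*b+1) then t else
      if y \<in> {(2*a+2, 2*b), (2*a, 2*b+2), (2*a+1, 2*b), (2*a, 2*b+1)} then W (2*a+1, 2*b+1) y / 4 else 0)"
  using deg_mid[OF assms, of "(2*a+1, 2*b)"] deg_mid[OF assms, of "(2*a, 2*b+1)"] deg_mid[OF assms, of "(2*a+1, 2*b+1)"]
  by (auto simp: lap_mat_def adj_mid_explicit[OF assms] mid_def)

lemma cell_sum_expand:
  assumes "(a, b) \<in> cells n"
  shows "cell_sum n (a, b) u y = path_weight u (2*a+1, 2*b) * lap_mat (Suc n) W t (2*a+1, 2*b) y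
    + path_weight u (2*a, 2*b+1) * lap_mat (Suc n) W t (2*a, 2*b+1) y
    + path_weight u (2*a+1, 2*b+1) * lap_mat (Suc n) W t (2*a+1, 2*b+1) y"
  by (simp add: cell_sum_def mid_def)

lemma path_weight_corner:
  "path_weight (2*a, 2*b) (2*a+1, 2*b) = A * W (2*a, 2*b) (2*a+1, 2*b)"
  "path_weight (2*a, 2*b) (2*a, 2*b+1) = A * W (2*a, 2*b) (2*a, 2*b+1)"
  "path_weight (2*a, 2*b) (2*a+1, 2*b+1) = B * W (2*a, 2*b) (2*a+1, 2*b) * W (2*a+1, 2*b) (2*a+1, 2*b+1)"
  "path_weight (2*a+2, 2*b) (2*a+1, 2*b) = A * W (2*a+2, 2*b) (2*a+1, 2*b)"
  "path_weight (2*a+2, 2*b) (2*a+1, 2*b+1) = A * W (2*a+2, 2*b) (2*a+1, 2*b+1)"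
  "path_weight (2*a+2, 2*b) (2*a, 2*b+1) = B * W (2*a+2, 2*b) (2*a+1, 2*b) * W (2*a+1, 2*b) (2*a, 2*b+1)"
  "path_weight (2*a, 2*b+2) (2*a, 2*b+1) = A * W (2*a, 2*b+2) (2*a, 2*b+1)"
  "path_weight (2*a, 2*b+2) (2*a+1, 2*b+1) = A * W (2*a, 2*b+2) (2*a+1, 2*b+1)"
  "path_weight (2*a, 2*b+2) (2*a+1, 2*b) = B * W (2*a, 2*b+2) (2*a, 2*b+1) * W (2*a, 2*b+1) (2*a+1, 2*b)"
  by (simp_all add: path_weight_def Let_def)

lemma renorm_cell:
  "renorm W (a, b) (a+1, b) = W (2*a, 2*b) (2*a+1, 2*b) * W (2*a+1, 2*b) (2*a+2, 2*b)"
  "renorm W (a, b) (a, b+1) = W (2*a, 2*b) (2*a, 2*b+1) * W (2*a, 2*b+1) (2*a, 2*b+2)"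
  "renorm W (a+1, b) (a, b) = W (2*a+2, 2*b) (2*a+1, 2*b) * W (2*a+1, 2*b) (2*a, 2*b)"
  "renorm W (a+1, b) (a, b+1) = W (2*a+2, 2*b) (2*a+1, 2*b+1) * W (2*a+1, 2*b+1) (2*a, 2*b+2)"
  "renorm W (a, b+1) (a, b) = W (2*a, 2*b+2) (2*a, 2*b+1) * W (2*a, 2*b+1) (2*a, 2*b)"
  "renorm W (a, b+1) (a+1, b) = W (2*a, 2*b+2) (2*a+1, 2*b+1) * W (2*a+1, 2*b+1) (2*a+2, 2*b)"
  by (simp_all add: renorm_def dbl_def mult_2 ac_simps)

text \<open>These are the rotated and reversed triangles required to apply
  \<open>hexagon_identities\<close> at each of the three corners.\<close>

lemma hol_cell':
  "hol W e (2*a, 2*b) (2*a, 2*b+1) (2*a+1, 2*b)"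
  "hol W e (2*a+2, 2*b) (2*a+1, 2*b) (2*a+1, 2*b+1)"
  "hol W e (2*a+2, 2*b) (2*a+1, 2*b+1) (2*a+1, 2*b)"
  "hol W e (2*a, 2*b+2) (2*a+1, 2*b+1) (2*a, 2*b+1)"
  "hol W e (2*a, 2*b+2) (2*a, 2*b+1) (2*a+1, 2*b+1)"
  "hol W f (2*a+1, 2*b+1) (2*a+1, 2*b) (2*a, 2*b+1)"
  "hol W f (2*a, 2*b+1) (2*a+1, 2*b) (2*a+1, 2*b+1)"
  "hol W f (2*a+1, 2*b) (2*a, 2*b+1) (2*a+1, 2*b+1)"
  by (rule hol_flip[OF hol_cell(1) ee] hol_flip[OF hol_rotate[OF hol_cell(2)] ee] hol_rotate[OF hol_cell(2)]
      hol_flip[OF hol_rotate[OF hol_rotate[OF hol_cell(3)]] ee] hol_rotate[OF hol_rotate[OF hol_cell(3)]]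
      hol_flip[OF hol_rotate[OF hol_cell(4)] ff] hol_rotate[OF hol_rotate[OF hol_cell(4)]] hol_flip[OF hol_cell(4) ff])+

text \<open>The corner \<open>c\<close> is the lower left, the lower right and the top one in turn;
  \<open>m1\<close> is always the midpoint through which \<open>path_weight\<close> reaches the
  opposite one.\<close>

lemmas hexagon_0 = hexagon_identities[OF hol_cell(1) hol_cell'(2,5,6) ee ff \<delta> AB B]
lemmas hexagon_1 = hexagon_identities[OF hol_cell'(2) hol_cell(1) hol_cell'(4,7) ee ff \<delta> AB B]
lemmas hexagon_2 = hexagon_identities[OF hol_cell'(5,1,3,8) ee ff \<delta> AB B]

lemmas complex_ac = add.assoc[where 'a=complex] add.commute[where 'a=complex] add.left_commute[where 'a=complex]

lemma adj_corner:
  assumes "(a, b) \<in> cells n"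
  shows "adj (Suc n) (2*a, 2*b) (2*a+1, 2*b)" "adj (Suc n) (2*a, 2*b) (2*a, 2*b+1)"
    "\<not> adj (Suc n) (2*a, 2*b) (2*a+1, 2*b+1)"
    "adj (Suc n) (2*a+2, 2*b) (2*a+1, 2*b)" "\<not> adj (Suc n) (2*a+2, 2*b) (2*a, 2*b+1)"
    "adj (Suc n) (2*a+2, 2*b) (2*a+1, 2*b+1)"
    "\<not> adj (Suc n) (2*a, 2*b+2) (2*a+1, 2*b)" "adj (Suc n) (2*a, 2*b+2) (2*a, 2*b+1)"
    "adj (Suc n) (2*a, 2*b+2) (2*a+1, 2*b+1)"
  using adj_mid_explicit[OF assms] by (simp_all add: adj_sym[of "Suc n" "(2*a, 2*b)"]
    adj_sym[of "Suc n" "(2*a+2, 2*b)"] adj_sym[of "Suc n" "(2*a, 2*b+2)"])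

lemma tri_cases:
  assumes "x \<in> tri (a, b)"
  obtains "x = (a, b)" | "x = (a+1, b)" | "x = (a, b+1)"
  using assms by (auto simp: tri_def)

lemma mid_cases:
  assumes "m \<in> mid (a, b)"
  obtains "m = (2*a+1, 2*b)" | "m = (2*a, 2*b+1)" | "m = (2*a+1, 2*b+1)"
  using assms by (auto simp: mid_def)


text \<open>The first three hexagon identities say that the midpoint rows reproduce
  \<open>\<delta>\<close> times the corner row in the midpoint columns. The factor
  \<open>1/deg\<close> of the corner row is left to \<open>elim_mat\<close>.\<close>

lemma cell_sum_mid:
  assumes p: "(a, b) \<in> cells n" and x: "x \<in> tri (a, b)" and y: "y \<in> mid (a, b)"
  shows "cell_sum n (a, b) (dbl x) y = \<delta> * (if adj (Suc n) (dbl x) y then W (dbl x) y else 0)"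
  apply (rule tri_cases[OF x]; rule mid_cases[OF y])
          apply (simp_all add: cell_sum_expand[OF p] lap_mat_mid[OF p] adj_corner[OF p] path_weight_corner dbl_def)
  apply (insert hexagon_0(1-3)[of a b], simp_all only: complex_ac)[3]
  apply (insert hexagon_1(1-3)[of a b], simp_all only: complex_ac)[3]
  apply (insert hexagon_2(1-3)[of a b], simp_all only: complex_ac)[3]
  done

lemma cell_sum_same:
  assumes p: "(a, b) \<in> cells n" and x: "x \<in> tri (a, b)"
  shows "cell_sum n (a, b) (dbl x) (dbl x) = A / 2"
  apply (rule tri_cases[OF x])
    apply (simp_all add: cell_sum_expand[OF p] lap_mat_mid[OF p] path_weight_corner dbl_def)
  apply (insert hexagon_0(4)[of a b], simp only: ac_simps)
  apply (insert hexagon_1(4)[of a b], simp only: ac_simps)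
  apply (insert hexagon_2(4)[of a b], simp only: ac_simps)
  done

text \<open>The other corner is reached straight through the common midpoint with weight
  \<open>A\<close>, and by the detour over the opposite midpoint with weight \<open>B\<close>. The
  detour costs a factor \<open>e\<close>, which gives \<open>(A + B * e) / 4\<close> in
  total.\<close>

lemma cell_sum_corner:
  assumes p: "(a, b) \<in> cells n" and x: "x \<in> tri (a, b)" and y: "y \<in> tri (a, b)" and "x \<noteq> y"
  shows "cell_sum n (a, b) (dbl x) (dbl y) = - \<psi> * renorm W x y"
  unfolding \<psi> minus_minus
  using \<open>x \<noteq> y\<close>
  apply (rule_tac tri_cases[OF x]; rule_tac tri_cases[OF y])
          apply (simp_all only: cell_sum_expand[OF p] simp_thms)
  apply (simp_all add: lap_mat_mid[OF p] path_weight_corner dbl_def renorm_cell)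
  apply (insert hexagon_0(5,6)[of a b], simp_all only: complex_ac)[2]
  apply (insert hexagon_1(5,6)[of a b], simp_all only: complex_ac)[2]
  apply (insert hexagon_2(5,6)[of a b], simp_all only: complex_ac)[2]
  done

end

section \<open>The determinant recursion\<close>

lemma tri_of_subcell: "q \<in> tri (dbl p) \<Longrightarrow> y \<in> tri q \<Longrightarrow> y \<in> dbl ` tri p \<union> mid p"
  using tri_subdivision by blast

context decimation begin

abbreviation M where "M n \<equiv> lap_mat (Suc n) W t"

lemma cell_sum_outside: "x \<notin> tri p \<Longrightarrow> cell_sum n p (dbl x) y = 0"
  by (simp add: cell_sum_def path_weight_0)

lemma lap_mat_mid_0:
  assumes "p \<in> cells n" "m \<in> mid p" "y \<noteq> m" "y \<notin> dbl ` tri p \<union> mid p"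
  shows "M n m y = 0"
proof -
  have "\<not> adj (Suc n) m y"
    using assms tri_subdivision[of p] by (auto simp: adj_mid[OF assms(1,2)])
  then show ?thesis using assms by (simp add: lap_mat_def)
qed

lemma cell_sum_column_outside:
  assumes "p \<in> cells n" "y \<notin> dbl ` tri p \<union> mid p"
  shows "cell_sum n p u y = 0"
  unfolding cell_sum_def
proof (rule sum.neutral, rule ballI)
  fix m assume m: "m \<in> mid p"
  then have "y \<noteq> m" using assms by auto
  then show "path_weight u m * M n m y = 0" using lap_mat_mid_0[OF assms(1) m] assms(2) by simp
qed

lemma sum_mids: "(\<Sum>m\<in>mids n. path_weight u m * M n m y) = (\<Sum>p\<in>cells n. cell_sum n p u y)"
  unfolding mids_def cell_sum_def
  by (rule sum.UNION_disjoint) (use mid_disjoint in auto)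

lemma sum_mids_mid:
  assumes "y \<in> mids n"
  shows "(\<Sum>m\<in>mids n. path_weight (dbl x) m * M n m y) = \<delta> * (if adj (Suc n) (dbl x) y then W (dbl x) y else 0)"
proof -
  obtain q where q: "q \<in> cells n" "y \<in> mid q" using assms by (auto simp: mids_def)
  have "(\<Sum>p\<in>cells n. cell_sum n p (dbl x) y) = (\<Sum>p\<in>{q}. cell_sum n p (dbl x) y)"
  proof (rule sum.mono_neutral_right)
    show "\<forall>p\<in>cells n - {q}. cell_sum n p (dbl x) y = 0"
    proof
      fix p assume p: "p \<in> cells n - {q}"
      then have "y \<notin> dbl ` tri p \<union> mid p" using q dbl_notin_mid mid_disjoint by blast
      then show "cell_sum n p (dbl x) y = 0" using cell_sum_column_outside p by blast
    qed
  qed (use q in auto)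
  also have "\<dots> = \<delta> * (if adj (Suc n) (dbl x) y then W (dbl x) y else 0)"
  proof (cases "x \<in> tri q")
    case True
    then show ?thesis using cell_sum_mid[of "fst q" "snd q" n x y] q by simp
  next
    case False
    have "\<not> adj (Suc n) y (dbl x)"
      using False tri_of_subcell[of _ q "dbl x"] by (simp add: adj_mid[OF q] image_iff) blast
    then show ?thesis using False by (simp add: cell_sum_outside adj_sym[of "Suc n" y])
  qed
  finally show ?thesis by (simp add: sum_mids)
qed

text \<open>The vertex \<open>x\<close> lies in \<open>deg n x / 2\<close> cells, and each
  contributes \<open>A / 2\<close>.\<close>

lemma sum_mids_same:
  assumes "x \<in> vert n"
  shows "(\<Sum>m\<in>mids n. path_weight (dbl x) m * M n m (dbl x)) = A / 4 * of_nat (deg n x)"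
proof -
  have "(\<Sum>p\<in>cells n. cell_sum n p (dbl x) (dbl x)) = (\<Sum>p\<in>{p\<in>cells n. x \<in> tri p}. cell_sum n p (dbl x) (dbl x))"
    by (rule sum.mono_neutral_right) (auto simp: cell_sum_outside)
  also have "\<dots> = (\<Sum>p\<in>{p\<in>cells n. x \<in> tri p}. A / 2)"
    by (rule sum.cong) (auto simp: cell_sum_same)
  finally show ?thesis by (simp add: sum_mids deg_def)
qed

lemma sum_mids_corner:
  assumes "x \<noteq> y"
  shows "(\<Sum>m\<in>mids n. path_weight (dbl x) m * M n m (dbl y)) = (if adj n x y then - \<psi> * renorm W x y else 0)"
proof -
  have out: "cell_sum n p (dbl x) (dbl y) = 0" if "p \<in> cells n" "\<not> (x \<in> tri p \<and> y \<in> tri p)" for p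
  proof (cases "x \<in> tri p")
    case True
    then have "dbl y \<notin> dbl ` tri p \<union> mid p" using that by (simp add: image_iff)
    then show ?thesis using cell_sum_column_outside that by blast
  qed (simp add: cell_sum_outside)
  show ?thesis
  proof (cases "adj n x y")
    case True
    then obtain q where q: "q \<in> cells n" "x \<in> tri q" "y \<in> tri q" by (auto simp: adj_def)
    have "(\<Sum>p\<in>cells n. cell_sum n p (dbl x) (dbl y)) = (\<Sum>p\<in>{q}. cell_sum n p (dbl x) (dbl y))"
    proof (rule sum.mono_neutral_right)
      show "\<forall>p\<in>cells n - {q}. cell_sum n p (dbl x) (dbl y) = 0"
      proof
        fix p assume p: "p \<in> cells n - {q}"
        then have "\<not> (x \<in> tri p \<and> y \<in> tri p)" using tri_two_points[OF _ _ q(2,3) assms] by blast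
        then show "cell_sum n p (dbl x) (dbl y) = 0" using out p by blast
      qed
    qed (use q in auto)
    then show ?thesis using True cell_sum_corner[of "fst q" "snd q" n x y] q assms by (simp add: sum_mids)
  next
    case False
    then have "(\<Sum>p\<in>cells n. cell_sum n p (dbl x) (dbl y)) = 0"
      using out assms by (intro sum.neutral ballI) (unfold adj_def, blast)
    then show ?thesis using False by (simp add: sum_mids)
  qed
qed

text \<open>This encodes the row operations. Old rows are scaled by \<open>\<delta>\<close> instead
  of the weights being divided by it, so the result also holds where \<open>\<delta>\<close>
  vanishes.\<close>

definition elim_mat :: "nat \<Rightarrow> int \<times> int \<Rightarrow> int \<times> int \<Rightarrow> complex" where
  "elim_mat n u v = (if u \<in> mids n then (if u = v then 1 else 0)
     else if v \<in> mids n then - path_weight u v / of_nat (deg (Suc n) u)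
     else if u = v then \<delta> else 0)"

lemma elim_row_coarse:
  assumes x: "x \<in> vert n"
  shows "(\<Sum>v\<in>vert (Suc n). elim_mat n (dbl x) v * M n v y)
    = \<delta> * M n (dbl x) y - (\<Sum>m\<in>mids n. path_weight (dbl x) m * M n m y) / of_nat (deg n x)"
proof -
  have "(\<Sum>v\<in>vert (Suc n). elim_mat n (dbl x) v * M n v y)
     = (\<Sum>v\<in>dbl ` vert n. elim_mat n (dbl x) v * M n v y) + (\<Sum>v\<in>mids n. elim_mat n (dbl x) v * M n v y)"
    unfolding vert_Suc by (rule sum.union_disjoint) (use dbl_notin_mids in auto)
  also have "(\<Sum>v\<in>dbl ` vert n. elim_mat n (dbl x) v * M n v y) = (\<Sum>v\<in>dbl ` vert n. if v = dbl x then \<delta> * M n (dbl x) y else 0)"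
    by (rule sum.cong) (auto simp: elim_mat_def dbl_notin_mids)
  also have "\<dots> = \<delta> * M n (dbl x) y" using x by simp
  also have "(\<Sum>v\<in>mids n. elim_mat n (dbl x) v * M n v y) = (\<Sum>m\<in>mids n. (path_weight (dbl x) m * M n m y) * (- (1 / of_nat (deg n x))))"
    by (rule sum.cong) (auto simp: elim_mat_def dbl_notin_mids deg_dbl)
  finally show ?thesis unfolding sum_distrib_right[symmetric] by simp
qed

lemma elim_row_mids:
  assumes "u \<in> mids n"
  shows "(\<Sum>v\<in>vert (Suc n). elim_mat n u v * M n v y) = M n u y"
proof -
  have "(\<Sum>v\<in>vert (Suc n). elim_mat n u v * M n v y) = (\<Sum>v\<in>vert (Suc n). if v = u then M n u y else 0)"
    using assms by (intro sum.cong) (auto simp: elim_mat_def)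
  then show ?thesis using assms by (simp add: vert_Suc)
qed

text \<open>Midpoints of different cells are not adjacent, so the block is block diagonal with one 3
  by 3 determinant per cell, depending only on the inner holonomy \<open>f\<close>.\<close>

lemma det_mids: "fdet (mids n) (M n) = ((t + f / 2) * (t - f / 4)\<^sup>2) ^ 3 ^ n"
proof -
  have "fdet (mids n) (M n) = (\<Prod>p\<in>cells n. fdet (mid p) (M n))"
    unfolding mids_def
  proof (rule fdet_UN)
    fix p q x y assume pq: "p \<in> cells n" "q \<in> cells n" "p \<noteq> q" "x \<in> mid p" "y \<in> mid q"
    have "y \<notin> dbl ` tri p \<union> mid p" using pq dbl_notin_mid mid_disjoint by blast
    then show "M n x y = 0" using lap_mat_mid_0[OF pq(1,4), of y] pq(4) by blast
  qed (use mid_disjoint in auto)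
  also have "\<dots> = (\<Prod>p\<in>cells n. (t + f / 2) * (t - f / 4)\<^sup>2)"
  proof (rule prod.cong[OF refl])
    fix p assume "p \<in> cells n"
    moreover obtain a b where p: "p = (a, b)" by (cases p)
    ultimately have c: "(a, b) \<in> cells n" by simp
    define ma mb mc where "ma = (2*a+1, 2*b)" and "mb = (2*a, 2*b+1)" and "mc = (2*a+1, 2*b+1)"
    have h: "hol W f ma mb mc" "hol W f ma mc mb" using hol_cell'(8) hol_cell(4) by (auto simp: ma_def mb_def mc_def)
    have inv: "W ma mb * W mb ma = 1" "W mb mc * W mc mb = 1" "W ma mc * W mc ma = 1"
      and loop: "W ma mb * W mb mc * W mc ma = f" "W ma mc * W mc mb * W mb ma = f"
      using h by (auto simp: hol_def)
    have "fdet (mid p) (M n) = M n ma ma * (M n mb mb * M n mc mc - M n mb mc * M n mc mb)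
      - M n ma mb * (M n mb ma * M n mc mc - M n mb mc * M n mc ma)
      + M n ma mc * (M n mb ma * M n mc mb - M n mb mb * M n mc ma)"
      unfolding mid_def p fst_conv snd_conv ma_def mb_def mc_def by (rule fdet_3) simp
    also have "\<dots> = t * (t * t - W mb mc / 4 * (W mc mb / 4)) - W ma mb / 4 * (W mb ma / 4 * t - W mb mc / 4 * (W mc ma / 4))
      + W ma mc / 4 * (W mb ma / 4 * (W mc mb / 4) - t * (W mc ma / 4))"
      using lap_mat_mid[OF c] by (simp add: ma_def mb_def mc_def)
    also have "\<dots> = t ^ 3 - t / 16 * (W mb mc * W mc mb) - t / 16 * (W ma mb * W mb ma) - t / 16 * (W ma mc * W mc ma)
      + (W ma mb * W mb mc * W mc ma) / 64 + (W ma mc * W mc mb * W mb ma) / 64"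
      by (simp add: algebra_simps power3_eq_cube)
    \<comment> \<open>Inserting \<open>f * f = 1\<close> makes the cubic homogeneous in
      \<open>t\<close> and \<open>f\<close>, so that it factors identically.\<close>
    also have "\<dots> = t ^ 3 - 3 * t / 16 * (f * f) + f * (f * f) / 32"
      unfolding inv loop ff by (simp add: field_simps)
    also have "\<dots> = (t + f / 2) * (t - f / 4)\<^sup>2"
      by (simp add: field_simps power2_eq_square power3_eq_cube)
    finally show "fdet (mid p) (M n) = (t + f / 2) * (t - f / 4)\<^sup>2" .
  qed
  finally show ?thesis by (simp add: card_cells)
qed

lemma det_elim_mat: "fdet (vert (Suc n)) (elim_mat n) = \<delta> ^ card (vert n)"
proof -
  have "fdet (vert (Suc n)) (elim_mat n) = fdet (dbl ` vert n) (elim_mat n) * fdet (mids n) (elim_mat n)"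
    unfolding vert_Suc
    by (rule fdet_block) (use dbl_notin_mids in \<open>auto simp: elim_mat_def\<close>)
  also have "fdet (dbl ` vert n) (elim_mat n) = fdet (dbl ` vert n) (\<lambda>u v. if u = v then \<delta> else 0)"
    by (rule fdet_cong) (auto simp: elim_mat_def dbl_notin_mids)
  also have "\<dots> = \<delta> ^ card (vert n)"
    by (simp add: fdet_scalar card_image inj_dbl)
  also have "fdet (mids n) (elim_mat n) = fdet (mids n) (\<lambda>u v. if u = v then 1 else 0)"
    by (rule fdet_cong) (auto simp: elim_mat_def)
  also have "\<dots> = 1" by (simp add: fdet_id)
  finally show ?thesis by simp
qed

text \<open>Multiplying by \<open>elim_mat\<close> from the left clears the midpoint columns of the
  old rows. The product is block triangular, with the midpoint block and \<open>\<psi>\<close> times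
  the coarse matrix on the diagonal.\<close>

theorem decimation_det:
  "\<delta> ^ card (vert n) * fdet (vert (Suc n)) (lap_mat (Suc n) W t)
    = ((t + f / 2) * (t - f / 4)\<^sup>2) ^ 3 ^ n * \<psi> ^ card (vert n) * fdet (vert n) (lap_mat n (renorm W) \<tau>)"
proof -
  let ?R = "\<lambda>u y. \<Sum>v\<in>vert (Suc n). elim_mat n u v * M n v y"
  have coarse_mids: "?R (dbl x) y = 0" if "x \<in> vert n" "y \<in> mids n" for x y
  proof -
    have "dbl x \<noteq> y" using that(2) dbl_notin_mids[of x n] by metis
    then show ?thesis
      unfolding elim_row_coarse[OF that(1)] sum_mids_mid[OF that(2)]
      by (simp add: lap_mat_def deg_dbl)
  qed
  \<comment> \<open>The diagonal entry becomes \<open>\<delta> * t - A / 4\<close>, which is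
    \<open>\<psi> * \<tau>\<close>. Off the diagonal the original entry is zero, and only the
    transport through midpoints remains.\<close>
  have coarse: "?R (dbl x) (dbl y) = \<psi> * lap_mat n (renorm W) \<tau> x y" if "x \<in> vert n" "y \<in> vert n" for x y
  proof (cases "x = y")
    case True
    have "deg n x \<noteq> 0" using deg_pos[OF that(1)] by simp
    then show ?thesis
      unfolding elim_row_coarse[OF that(1)] True[symmetric] sum_mids_same[OF that(1)]
      using \<tau> by (simp add: lap_mat_def)
  next
    case False
    then show ?thesis
      unfolding elim_row_coarse[OF that(1)] sum_mids_corner[OF False]
      using False not_adj_dbl[of n x y] by (simp add: lap_mat_def)
  qed
  have "\<delta> ^ card (vert n) * fdet (vert (Suc n)) (M n) = fdet (vert (Suc n)) ?R"
    by (simp add: fdet_mult det_elim_mat)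
  also have "\<dots> = fdet (dbl ` vert n) ?R * fdet (mids n) ?R"
    unfolding vert_Suc
    by (rule fdet_block) (use dbl_notin_mids coarse_mids in \<open>auto simp: vert_Suc\<close>)
  also have "fdet (mids n) ?R = fdet (mids n) (M n)"
    by (rule fdet_cong) (auto simp: elim_row_mids)
  also have "fdet (dbl ` vert n) ?R = fdet (vert n) (\<lambda>x y. ?R (dbl x) (dbl y))"
    by (rule fdet_image) (auto simp: inj_dbl)
  also have "\<dots> = fdet (vert n) (\<lambda>x y. \<psi> * lap_mat n (renorm W) \<tau> x y)"
    by (rule fdet_cong) (auto simp: coarse)
  also have "\<dots> = \<psi> ^ card (vert n) * fdet (vert n) (lap_mat n (renorm W) \<tau>)"
    by (simp add: fdet_smult)
  finally show ?thesis by (simp add: det_mids)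
qed

end

section \<open>From the planar graphs to lattice coordinates\<close>

lemma hol_coarse:
  assumes h: "hol W g m1 y m2" "hol W g m2 z m3" "hol W g m3 x m1" "hol W h m1 m2 m3"
    and gg: "g * g = 1"
    and V: "V X Y = W x m1 * W m1 y" "V Y X = W y m1 * W m1 x"
      "V Y Z = W y m2 * W m2 z" "V Z Y = W z m2 * W m2 y"
      "V Z X = W z m3 * W m3 x" "V X Z = W x m3 * W m3 z"
  shows "hol V (g * h) X Y Z"
proof -
  have i: "W m1 y * W y m1 = 1" "W y m2 * W m2 y = 1" "W m2 z * W z m2 = 1"
    "W z m3 * W m3 z = 1" "W m3 x * W x m3 = 1" "W x m1 * W m1 x = 1"
    using h by (auto simp: hol_def)
  note p = hol_path[OF h(1)] hol_path[OF h(2)] hol_path[OF h(3)]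
  have "V X Y * V Y X = (W x m1 * W m1 x) * (W m1 y * W y m1)" unfolding V by (simp only: ac_simps)
  then have 1: "V X Y * V Y X = 1" unfolding i by simp
  have "V Y Z * V Z Y = (W y m2 * W m2 y) * (W m2 z * W z m2)" unfolding V by (simp only: ac_simps)
  then have 2: "V Y Z * V Z Y = 1" unfolding i by simp
  have "V X Z * V Z X = (W m3 x * W x m3) * (W z m3 * W m3 z)" unfolding V by (simp only: ac_simps)
  then have 3: "V X Z * V Z X = 1" unfolding i by simp
  \<comment> \<open>Regrouping around the corners \<open>y\<close>, \<open>z\<close>,
    \<open>x\<close> replaces each detour over a corner by \<open>g\<close> times a side of the
    inner triangle.\<close>
  have "V X Y * V Y Z * V Z X = (W m1 y * W y m2) * (W m2 z * W z m3) * (W m3 x * W x m1)"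
    unfolding V by (simp only: ac_simps)
  also have "\<dots> = (g * W m1 m2) * (g * W m2 m3) * (g * W m3 m1)"
    unfolding p ..
  also have "\<dots> = (g * g) * g * (W m1 m2 * W m2 m3 * W m3 m1)" by (simp only: ac_simps)
  also have "\<dots> = g * h" using h(4) unfolding gg by (simp add: hol_def)
  finally show ?thesis using 1 2 3 by (simp add: hol_def)
qed

text \<open>A coarse upward triangle consists of three upward triangles and one downward triangle,
  giving \<open>e^3 * f = e * f\<close>. For a coarse downward triangle the roles of
  \<open>e\<close> and \<open>f\<close> are exchanged.\<close>

lemma has_flux_renorm:
  assumes W: "has_flux e f W" and ee: "e * e = 1" and ff: "f * f = 1"
  shows "has_flux (e * f) (e * f) (renorm W)"
  unfolding has_flux_def
proof (intro allI conjI)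
  fix a b
  have up: "hol W e (a, b) (a+1, b) (a, b+1)" and down: "hol W f (a+1, b) (a+1, b+1) (a, b+1)" for a b
    using W by (auto simp: has_flux_def)
  have u: "hol W e (2*a+1, 2*b) (2*a+2, 2*b) (2*a+1, 2*b+1)" "hol W e (2*a+1, 2*b+1) (2*a, 2*b+2) (2*a, 2*b+1)"
    "hol W e (2*a, 2*b+1) (2*a, 2*b) (2*a+1, 2*b)" "hol W f (2*a+1, 2*b) (2*a+1, 2*b+1) (2*a, 2*b+1)"
    using up[of "2*a+1" "2*b"] hol_rotate[OF up[of "2*a" "2*b+1"]] hol_rotate[OF hol_rotate[OF up[of "2*a" "2*b"]]]
      down[of "2*a" "2*b"]
    by (simp_all add: add.assoc)
  show "hol (renorm W) (e * f) (a, b) (a + 1, b) (a, b + 1)"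
    by (rule hol_coarse[OF u ee]) (simp_all add: renorm_def dbl_def mult_2 ac_simps)
  have d: "hol W f (2*a+2, 2*b+1) (2*a+2, 2*b+2) (2*a+1, 2*b+2)" "hol W f (2*a+1, 2*b+2) (2*a, 2*b+2) (2*a+1, 2*b+1)"
    "hol W f (2*a+1, 2*b+1) (2*a+2, 2*b) (2*a+2, 2*b+1)" "hol W e (2*a+2, 2*b+1) (2*a+1, 2*b+2) (2*a+1, 2*b+1)"
    using down[of "2*a+1" "2*b+1"] hol_rotate[OF down[of "2*a" "2*b+1"]] hol_rotate[OF hol_rotate[OF down[of "2*a+1" "2*b"]]]
      hol_rotate[OF up[of "2*a+1" "2*b+1"]]
    by (simp_all add: add.assoc)
  have "hol (renorm W) (f * e) (a + 1, b) (a + 1, b + 1) (a, b + 1)"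
    by (rule hol_coarse[OF d ff]) (simp_all add: renorm_def dbl_def mult_2 ac_simps)
  then show "hol (renorm W) (e * f) (a + 1, b) (a + 1, b + 1) (a, b + 1)" by (simp add: mult.commute)
qed

section \<open>Lattice coordinates as points of the plane\<close>

definition emb :: "int \<times> int \<Rightarrow> complex" where
  "emb p = of_int (fst p) + of_int (snd p) * omega0"

lemma inj_emb: "inj_on emb A"
proof (rule inj_onI)
  fix p q assume "emb p = emb q"
  then have "Im (emb p) = Im (emb q)" "Re (emb p) = Re (emb q)" by auto
  then show "p = q" by (auto simp: emb_def omega0_def prod_eq_iff)
qed

lemma emb_eq_iff [simp]: "emb p = emb q \<longleftrightarrow> p = q"
  using inj_emb[of UNIV] by (simp add: inj_eq)

lemma emb_in_tri_lattice: "emb p \<in> tri_lattice"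
  by (auto simp: emb_def tri_lattice_def)

lemma emb_shift:
  "emb (a + 1, b) = emb (a, b) + 1" "emb (a, b + 1) = emb (a, b) + omega0"
  "emb (a + 1, b + 1) = emb (a, b) + 1 + omega0"
  by (simp_all add: emb_def algebra_simps)

lemma cmod_omega0: "cmod omega0 = 1" "cmod (1 - omega0) = 1"
  by (simp_all add: omega0_def cmod_def power_divide)

lemma conn_inverse:
  assumes "unitary_connection_T w" "tri_edge x y"
  shows "w x y * w y x = 1"
proof -
  have "cmod (w x y) = 1" "w y x = cnj (w x y)" using assms by (auto simp: unitary_connection_T_def)
  then show ?thesis using complex_norm_square[of "w x y"] by simp
qed

lemma has_flux_conn:
  assumes "conn_with_flux \<alpha> \<beta> w"
  shows "has_flux (exp (2 * pi * \<i> * of_real \<alpha>)) (exp (2 * pi * \<i> * of_real \<beta>)) (\<lambda>x y. w (emb x) (emb y))"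
  unfolding has_flux_def
proof (intro allI conjI)
  fix a b
  let ?p = "emb (a, b)"
  have u: "unitary_connection_T w" using assms by (simp add: conn_with_flux_def)
  have in_T: "?p \<in> tri_lattice" "?p + 1 \<in> tri_lattice" "?p + omega0 \<in> tri_lattice" "?p + 1 + omega0 \<in> tri_lattice"
    using emb_in_tri_lattice[of "(a, b)"] emb_in_tri_lattice[of "(a+1, b)"] emb_in_tri_lattice[of "(a, b+1)"]
      emb_in_tri_lattice[of "(a+1, b+1)"] unfolding emb_shift by auto
  have fl: "w ?p (?p + 1) * w (?p + 1) (?p + omega0) * w (?p + omega0) ?p = exp (2 * pi * \<i> * of_real \<alpha>)"
    "w (?p + 1) (?p + 1 + omega0) * w (?p + 1 + omega0) (?p + omega0) * w (?p + omega0) (?p + 1) = exp (2 * pi * \<i> * of_real \<beta>)"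
    using assms in_T(1) by (auto simp: conn_with_flux_def)
  have edges: "tri_edge ?p (?p + 1)" "tri_edge (?p + 1) (?p + omega0)" "tri_edge ?p (?p + omega0)"
    "tri_edge (?p + 1) (?p + 1 + omega0)" "tri_edge (?p + 1 + omega0) (?p + omega0)"
    using in_T cmod_omega0 by (simp_all add: tri_edge_def)
  note inv = conn_inverse[OF u edges(1)] conn_inverse[OF u edges(2)] conn_inverse[OF u edges(3)]
    conn_inverse[OF u edges(4)] conn_inverse[OF u edges(5)]
  show "hol (\<lambda>x y. w (emb x) (emb y)) (exp (2 * pi * \<i> * of_real \<alpha>)) (a, b) (a + 1, b) (a, b + 1)"
    unfolding hol_def emb_shift using inv fl(1) by simp
  show "hol (\<lambda>x y. w (emb x) (emb y)) (exp (2 * pi * \<i> * of_real \<beta>)) (a + 1, b) (a + 1, b + 1) (a, b + 1)"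
    unfolding hol_def emb_shift using inv fl(2) by simp
qed

text \<open>This is translation by \<open>2^n\<close> times \<open>sg_x i\<close> in lattice
  coordinates, where \<open>sg_x 2\<close> is \<open>(1,0)\<close> and \<open>sg_x 1\<close> is
  \<open>(0,1)\<close>.\<close>

definition shift :: "nat \<Rightarrow> nat \<Rightarrow> int \<times> int \<Rightarrow> int \<times> int" where
  "shift n i p = (fst p + (if i = 2 then 2 ^ n else 0), snd p + (if i = 1 then 2 ^ n else 0))"

lemma emb_shift_cell: "i \<in> {0, 1, 2} \<Longrightarrow> emb (shift n i p) = emb p + 2 ^ n * sg_x i"
  by (auto simp: emb_def shift_def sg_x_def algebra_simps)

lemma tri_shift: "tri (shift n i p) = shift n i ` tri p"
  by (auto simp: tri_def shift_def)

lemma dbl_shift: "dbl (shift n i p) = shift (Suc n) i (dbl p)"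
  by (auto simp: dbl_def shift_def)

text \<open>The recursion of \<open>cells\<close> refines at the smallest scale, whereas the gasket
  is defined by joining three copies at the largest scale. Both yield the same cells because
  doubling commutes with translation up to the scale.\<close>

lemma cells_shift: "cells (Suc n) = (\<Union>i\<in>{0, 1, 2}. shift n i ` cells n)"
proof (induction n)
  case 0
  show ?case by (auto simp: tri_def shift_def dbl_def)
next
  case (Suc n)
  have "cells (Suc (Suc n)) = (\<Union>p\<in>cells (Suc n). tri (dbl p))" by simp
  also have "\<dots> = (\<Union>i\<in>{0, 1, 2}. \<Union>q\<in>cells n. tri (dbl (shift n i q)))"
    unfolding Suc by blast
  also have "\<dots> = (\<Union>i\<in>{0, 1, 2}. \<Union>q\<in>cells n. shift (Suc n) i ` tri (dbl q))"
    by (simp only: dbl_shift tri_shift)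
  also have "\<dots> = (\<Union>i\<in>{0, 1, 2}. shift (Suc n) i ` (\<Union>q\<in>cells n. tri (dbl q)))"
    by (simp only: image_UN)
  finally show ?case by simp
qed

definition edges :: "nat \<Rightarrow> ((int \<times> int) \<times> (int \<times> int)) set" where
  "edges n = {(x, y). adj n x y}"

lemma vert_shift: "vert (Suc n) = (\<Union>i\<in>{0, 1, 2}. shift n i ` vert n)"
proof -
  have "vert (Suc n) = (\<Union>i\<in>{0, 1, 2}. \<Union>p\<in>cells n. tri (shift n i p))"
    unfolding vert_def cells_shift by blast
  then show ?thesis by (simp only: tri_shift vert_def image_UN)
qed

lemma shift_eq_iff: "shift n i x = shift n i y \<longleftrightarrow> x = y"
  by (auto simp: shift_def prod_eq_iff)

lemma map_prod_off_diagonal: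
  assumes "inj f"
  shows "map_prod f f ` {(x, y). x \<noteq> y \<and> x \<in> A \<and> y \<in> A} = {(x, y). x \<noteq> y \<and> x \<in> f ` A \<and> y \<in> f ` A}"
    (is "?L = ?R")
proof (intro equalityI subrelI)
  fix u v assume "(u, v) \<in> ?R"
  then obtain x y where "x \<in> A" "y \<in> A" "u = f x" "v = f y" "x \<noteq> y" by auto
  then show "(u, v) \<in> ?L" by (intro image_eqI[of _ _ "(x, y)"]) auto
qed (use assms in \<open>auto simp: inj_eq\<close>)

lemma edges_UN: "edges n = (\<Union>p\<in>cells n. {(x, y). x \<noteq> y \<and> x \<in> tri p \<and> y \<in> tri p})"
  by (auto simp: edges_def adj_def)

lemma edges_shift: "edges (Suc n) = (\<Union>i\<in>{0, 1, 2}. map_prod (shift n i) (shift n i) ` edges n)"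
proof -
  have inj: "inj (shift n i)" for i by (rule injI) (simp add: shift_eq_iff)
  have "edges (Suc n) = (\<Union>i\<in>{0, 1, 2}. \<Union>p\<in>cells n. {(x, y). x \<noteq> y \<and> x \<in> tri (shift n i p) \<and> y \<in> tri (shift n i p)})"
    unfolding edges_UN cells_shift by blast
  also have "\<dots> = (\<Union>i\<in>{0, 1, 2}. map_prod (shift n i) (shift n i) ` edges n)"
    by (simp only: tri_shift edges_UN image_UN map_prod_off_diagonal[OF inj])
  finally show ?thesis .
qed

text \<open>After scaling by \<open>2^(n+1)\<close>, the contraction \<open>sg_Phi i\<close> turns
  into the translation by \<open>2^n * sg_x i\<close>.\<close>

lemma GV_Suc: "GV (Suc n) = (\<Union>i\<in>{0, 1, 2}. (\<lambda>z. z + 2 ^ n * sg_x i) ` GV n)"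
  unfolding GV_def sgV0.simps image_UN image_image
  by (intro SUP_cong refl image_cong) (simp add: sg_Phi_def field_simps)

lemma GE_Suc: "GE (Suc n) = (\<Union>i\<in>{0, 1, 2}. map_prod (\<lambda>z. z + 2 ^ n * sg_x i) (\<lambda>z. z + 2 ^ n * sg_x i) ` GE n)"
  unfolding GE_def sgE0.simps image_UN image_image
  by (intro SUP_cong refl image_cong) (auto simp: sg_Phi_def field_simps)

lemma GV_eq: "GV n = emb ` vert n"
proof (induction n)
  case 0
  show ?case by (auto simp: GV_def vert_def tri_def emb_def sg_x_def)
next
  case (Suc n)
  show ?case unfolding GV_Suc vert_shift Suc image_UN image_image
    by (intro SUP_cong refl image_cong) (simp add: emb_shift_cell)
qed

lemma GE_eq: "GE n = map_prod emb emb ` edges n"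
proof (induction n)
  case 0
  have "{sg_x 0, sg_x 1, sg_x 2} = emb ` tri (0, 0)" by (auto simp: tri_def emb_def sg_x_def)
  then have "GE 0 = {(x, y). x \<noteq> y \<and> x \<in> emb ` tri (0, 0) \<and> y \<in> emb ` tri (0, 0)}"
    unfolding GE_def sgE0.simps by (auto simp: map_prod_def)
  also have "\<dots> = map_prod emb emb ` edges 0"
    by (simp add: edges_UN map_prod_off_diagonal[OF inj_emb])
  finally show ?case .
next
  case (Suc n)
  show ?case unfolding GE_Suc edges_shift Suc image_UN image_image
    by (intro SUP_cong refl image_cong) (auto simp: emb_shift_cell)
qed

lemma card_adj: "card {y. adj n x y} = deg n x"
proof -
  have "{y. adj n x y} = (\<Union>p\<in>{p\<in>cells n. x \<in> tri p}. tri p - {x})" by (auto simp: adj_def)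
  also have "card \<dots> = (\<Sum>p\<in>{p\<in>cells n. x \<in> tri p}. card (tri p - {x}))"
  proof (rule card_UN_disjoint)
    show "\<forall>p\<in>{p\<in>cells n. x \<in> tri p}. \<forall>q\<in>{p\<in>cells n. x \<in> tri p}. p \<noteq> q \<longrightarrow> (tri p - {x}) \<inter> (tri q - {x}) = {}"
      using tri_two_points by blast
  qed auto
  also have "\<dots> = (\<Sum>p\<in>{p\<in>cells n. x \<in> tri p}. 2)"
    by (intro sum.cong refl) (auto simp: tri_def card_insert_if card_Diff_singleton_if prod_eq_iff)
  finally show ?thesis by (simp add: deg_def)
qed

lemma nbrs_eq: "nbrs (GV n) (GE n) (emb x) = emb ` {y. adj n x y}"
proof -
  have edge: "(emb x, v) \<in> GE n \<longleftrightarrow> (\<exists>y. adj n x y \<and> v = emb y)" for v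
  proof
    assume "(emb x, v) \<in> GE n"
    then obtain a b where "adj n a b" "emb x = emb a" "v = emb b" by (auto simp: GE_eq edges_def)
    then have "adj n x b \<and> v = emb b" by simp
    then show "\<exists>y. adj n x y \<and> v = emb y" by blast
  next
    assume "\<exists>y. adj n x y \<and> v = emb y"
    then obtain y where "adj n x y" "v = emb y" by blast
    then show "(emb x, v) \<in> GE n"
      unfolding GE_eq by (intro image_eqI[of _ _ "(x, y)"]) (simp_all add: edges_def)
  qed
  have "y \<in> vert n" if "adj n x y" for y using that by (auto simp: adj_def vert_def)
  then show ?thesis unfolding nbrs_def GV_eq edge by blast
qed

section \<open>The characteristic polynomial of the Laplacian\<close>

text \<open>At spectral parameter \<open>0\<close>, that is, \<open>t = -1\<close>, the matrix
  \<open>lap_mat\<close> is minus the Laplacian.\<close>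

definition spec_poly :: "nat \<Rightarrow> (int \<times> int \<Rightarrow> int \<times> int \<Rightarrow> complex) \<Rightarrow> complex poly" where
  "spec_poly n W = char_poly (fmat (enum_of (vert n)) (\<lambda>x y. - lap_mat n W (-1) x y))"

lemma poly_spec_poly: "poly (spec_poly n W) k = fdet (vert n) (lap_mat n W (k - 1))"
proof -
  note e = enum_of[OF finite_vert, of n]
  have "poly (spec_poly n W) k = fdet (vert n) (\<lambda>x y. (if x = y then k else 0) - - lap_mat n W (-1) x y)"
    unfolding spec_poly_def poly_char_poly_fmat[OF e(1)] e(2) ..
  also have "\<dots> = fdet (vert n) (lap_mat n W (k - 1))"
    by (rule fdet_cong) (auto simp: lap_mat_def)
  finally show ?thesis .
qed

lemma spec_poly_nonzero: "spec_poly n W \<noteq> 0"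
  using degree_monic_char_poly[OF fmat_carrier] unfolding spec_poly_def by (metis coeff_0 zero_neq_one)

lemma mag_lap_indicator:
  assumes "x \<in> vert n"
  shows "mag_lap (GV n) (GE n) w (\<lambda>z. if z = emb y then 1 else 0) (emb x)
    = - lap_mat n (\<lambda>x y. w (emb x) (emb y)) (-1) x y"
proof -
  have fin: "finite {z. adj n x z}"
    by (rule finite_subset[of _ "vert n"]) (auto simp: adj_def vert_def)
  have deg: "of_nat (deg n x) \<noteq> (0 :: complex)" using deg_pos[OF assms] by simp
  have card: "card (nbrs (GV n) (GE n) (emb x)) = deg n x"
    by (simp add: nbrs_eq card_image inj_emb card_adj)
  have "mag_lap (GV n) (GE n) w (\<lambda>z. if z = emb y then 1 else 0) (emb x)
      = (\<Sum>z\<in>{z. adj n x z}. ((if x = y then 1 else 0) - w (emb x) (emb z) * (if z = y then 1 else 0)) / of_nat (deg n x))"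
    unfolding mag_lap_def card by (simp add: nbrs_eq sum.reindex inj_emb)
  also have "\<dots> = - lap_mat n (\<lambda>x y. w (emb x) (emb y)) (-1) x y"
  proof (cases "x = y")
    case True
    have "(\<Sum>z\<in>{z. adj n x z}. ((if x = y then 1 else 0) - w (emb x) (emb z) * (if z = y then 1 else 0)) / of_nat (deg n x))
        = (\<Sum>z\<in>{z. adj n x z}. 1 / of_nat (deg n x))"
      using True by (intro sum.cong) (auto simp: adj_def)
    then show ?thesis using True deg by (simp add: card_adj lap_mat_def)
  next
    case False
    have "(\<Sum>z\<in>{z. adj n x z}. ((if x = y then 1 else 0) - w (emb x) (emb z) * (if z = y then 1 else 0)) / of_nat (deg n x))
        = (\<Sum>z\<in>{z. adj n x z}. if z = y then - w (emb x) (emb y) / of_nat (deg n x) else 0)"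
      using False by (intro sum.cong) auto
    then show ?thesis using False fin by (simp add: lap_mat_def)
  qed
  finally show ?thesis .
qed

text \<open>The enumerations of \<open>GV n\<close> and \<open>vert n\<close> are chosen
  independently, so the two characteristic polynomials are compared through their values, which are
  enumeration-free determinants.\<close>

lemma sg_spectrum_eq: "sg_spectrum n w = proots (spec_poly n (\<lambda>x y. w (emb x) (emb y)))"
proof -
  let ?F = "\<lambda>u v. mag_lap (GV n) (GE n) w (\<lambda>z. if z = v then 1 else 0) u"
  have fin: "finite (GV n)" by (simp add: GV_eq)
  note e = enum_of[OF fin]
  have "char_poly (fmat (enum_of (GV n)) ?F) = spec_poly n (\<lambda>x y. w (emb x) (emb y))"
  proof (rule iffD1[OF poly_eq_poly_eq_iff], rule ext)
    fix k
    have "poly (char_poly (fmat (enum_of (GV n)) ?F)) k = fdet (GV n) (\<lambda>u v. (if u = v then k else 0) - ?F u v)"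
      unfolding poly_char_poly_fmat[OF e(1)] e(2) ..
    also have "\<dots> = fdet (emb ` vert n) (\<lambda>u v. (if u = v then k else 0) - ?F u v)"
      by (rule arg_cong2[where f = fdet, OF GV_eq refl])
    also have "\<dots> = fdet (vert n) (\<lambda>x y. (if emb x = emb y then k else 0) - ?F (emb x) (emb y))"
      by (rule fdet_image) (auto simp: inj_emb)
    also have "\<dots> = fdet (vert n) (lap_mat n (\<lambda>x y. w (emb x) (emb y)) (k - 1))"
    proof (rule fdet_cong)
      fix x y assume "x \<in> vert n" "y \<in> vert n"
      then show "(if emb x = emb y then k else 0) - ?F (emb x) (emb y)
          = lap_mat n (\<lambda>x y. w (emb x) (emb y)) (k - 1) x y"
        unfolding mag_lap_indicator[OF \<open>x \<in> vert n\<close>] by (simp add: lap_mat_def)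
    qed simp
    finally show "poly (char_poly (fmat (enum_of (GV n)) ?F)) k = poly (spec_poly n (\<lambda>x y. w (emb x) (emb y))) k"
      by (simp add: poly_spec_poly)
  qed
  then show ?thesis
    unfolding sg_spectrum_def op_spectrum_def Let_def fmat_def enum_of_def by simp
qed

section \<open>Multisets of roots and the spectra\<close>

lemma preim_one: "preim g (Suc 0) a = proots (g - [:a:])"
  by (simp add: preim_def)

lemma preim_zero: "preim g 0 a = {#a#}"
  by (simp add: preim_def)

lemma pcompose_sub_const_nonzero:
  fixes R :: "complex poly"
  assumes "degree R > 0"
  shows "R - [:x:] \<noteq> 0"
  using assms by (metis degree_pCons_0 eq_iff_diff_eq_0 less_irrefl)

lemma pcompose_linear: "pcompose [:- x, 1:] (R :: complex poly) = R - [:x:]"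
  by (rule iffD1[OF poly_eq_poly_eq_iff]) (auto simp: fun_eq_iff poly_pcompose)

lemma proots_pcompose_prod:
  fixes R :: "complex poly"
  assumes R: "degree R > 0"
  shows "(\<Prod>x\<in>#A. R - [:x:]) \<noteq> 0 \<and> proots (\<Prod>x\<in>#A. R - [:x:]) = preim_mset R A"
proof (induction A)
  case empty
  then show ?case by (simp add: preim_mset_def)
next
  case (add x A)
  then show ?case
    using pcompose_sub_const_nonzero[OF R, of x] by (simp add: proots_mult preim_mset_def preim_one)
qed

lemma pcompose_prod_linear: "pcompose (\<Prod>x\<in>#A. [:- x, 1:]) (R :: complex poly) = (\<Prod>x\<in>#A. R - [:x:])"
  by (induction A) (simp_all add: pcompose_mult pcompose_linear del: mult_pCons_left mult_pCons_right pcompose_pCons)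

text \<open>Splitting \<open>p\<close> into linear factors turns the composition into a product of
  the polynomials \<open>R - x\<close> over the roots \<open>x\<close> of \<open>p\<close>.\<close>

lemma proots_pcompose:
  fixes p R :: "complex poly"
  assumes "p \<noteq> 0" "degree R > 0"
  shows "proots (pcompose p R) = preim_mset R (proots p)"
proof -
  have "pcompose p R = Polynomial.smult (lead_coeff p) (\<Prod>x\<in>#proots p. R - [:x:])"
    by (subst complex_poly_decompose_multiset[symmetric, of p])
      (simp add: pcompose_smult pcompose_prod_linear)
  then show ?thesis using proots_pcompose_prod[OF assms(2), of "proots p"] assms(1) by simp
qed

lemma preim_Suc:
  assumes "degree g > 0"
  shows "preim g (Suc k) a = preim_mset g (preim g k a)"
proof -
  define P where "P k = ((\<lambda>q. pcompose g q) ^^ k) [:0, 1:]" for k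
  \<comment> \<open>The definition of \<open>preim\<close> adds \<open>g\<close> on the outside.
    Moving it to the inside exhibits the next level as the preimage under \<open>g\<close> of the
    previous one.\<close>
  have P_Suc: "P (Suc k) = pcompose (P k) g" for k
  proof (induction k)
    case 0
    then show ?case by (simp add: P_def )
  next
    case (Suc k)
    have "P (Suc (Suc k)) = pcompose g (P (Suc k))" by (simp add: P_def)
    also have "\<dots> = pcompose (pcompose g (P k)) g" by (simp add: Suc pcompose_assoc)
    also have "pcompose g (P k) = P (Suc k)" by (simp add: P_def)
    finally show ?case .
  qed
  have "degree (P k) > 0" for k
    by (induction k) (use assms in \<open>simp_all add: P_Suc, simp_all add: P_def\<close>)
  then have "P k - [:a:] \<noteq> 0" by (rule pcompose_sub_const_nonzero)
  then have "proots (pcompose (P k - [:a:]) g) = preim_mset g (proots (P k - [:a:]))"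
    using assms by (rule proots_pcompose)
  moreover have "pcompose (P k - [:a:]) g = P (Suc k) - [:a:]"
    by (simp add: pcompose_diff P_Suc)
  ultimately show ?thesis by (simp add: preim_def P_def)
qed

lemma preim_mset_union [simp]: "preim_mset g (A + B) = preim_mset g A + preim_mset g B"
  by (simp add: preim_mset_def)

lemma preim_mset_empty [simp]: "preim_mset g {#} = {#}"
  by (simp add: preim_mset_def)

lemma preim_mset_repeat [simp]: "preim_mset g (repeat_mset n A) = repeat_mset n (preim_mset g A)"
  by (induction n) simp_all

lemma preim_mset_add_mset [simp]: "preim_mset g (add_mset a A) = preim g (Suc 0) a + preim_mset g A"
  by (simp add: preim_mset_def)

lemma preim_mset_replicate [simp]: "preim_mset g (replicate_mset n a) = repeat_mset n (preim g (Suc 0) a)"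
  by (induction n) simp_all

lemma preim_mset_sum [simp]: "preim_mset g (sum h I) = (\<Sum>i\<in>I. preim_mset g (h i))"
  by (induction I rule: infinite_finite_induct) simp_all

lemma proots_linear_1: "proots (Polynomial.smult (- (1/4)) [:- a, 1:]) = {#a :: complex#}"
  by (simp del: smult_pCons)

lemma proots_linear_2: "proots ([:- a, 1:] * [:- b, 1:]) = {#a, b :: complex#}"
  by (simp add: proots_mult del: mult_pCons_left mult_pCons_right)

lemma proots_linear_3: "proots ([:- a, 1:] * [:- b, 1:] * [:- c, 1:]) = {#a, b, c :: complex#}"
  by (simp add: proots_mult del: mult_pCons_left mult_pCons_right)

text \<open>These are the Vieta relations for \<open>-4 (z - r) (z - s)\<close>.\<close>

lemma preim_quadratic:
  assumes "c1 = 4 * (r + s)" "a - c0 = 4 * r * s"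
  shows "preim [:c0, c1, -4:] (Suc 0) a = {#r, s#}"
proof -
  have "[:c0, c1, -4:] - [:a:] = Polynomial.smult (-4) ([:- r, 1:] * [:- s, 1:])"
    using assms by (simp add: algebra_simps)
  then show ?thesis by (simp add: preim_one proots_linear_2 del: mult_pCons_left mult_pCons_right)
qed

section \<open>One decimation step for spectra\<close>

text \<open>The determinant recursion holds at every \<open>k\<close>, hence as an identity of
  nonzero polynomials. Taking roots turns products into multiset sums, and the power of
  \<open>\<Delta>\<close> stays on the left to avoid division.\<close>

lemma spec_step:
  fixes \<Delta> \<Psi> D R :: "complex poly"
  assumes dec: "\<And>k. decimation W e f (k - 1) (A k) (B k) (poly \<Delta> k) (poly \<Psi> k) (poly R k - 1)"
    and D: "\<And>k. poly D k = (k - 1 + f / 2) * (k - 1 - f / 4)\<^sup>2"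
    and nz: "\<Delta> \<noteq> 0" "\<Psi> \<noteq> 0" "D \<noteq> 0" and R: "degree R > 0"
  shows "proots (spec_poly (Suc n) W) + repeat_mset (card (vert n)) (proots \<Delta>)
    = repeat_mset (3 ^ n) (proots D) + repeat_mset (card (vert n)) (proots \<Psi>)
      + preim_mset R (proots (spec_poly n (renorm W)))"
proof -
  let ?v = "card (vert n)"
  have "spec_poly (Suc n) W * \<Delta> ^ ?v = D ^ 3 ^ n * \<Psi> ^ ?v * pcompose (spec_poly n (renorm W)) R"
  proof (rule iffD1[OF poly_eq_poly_eq_iff], rule ext)
    fix k
    interpret decimation W e f "k - 1" "A k" "B k" "poly \<Delta> k" "poly \<Psi> k" "poly R k - 1" by (rule dec)
    show "poly (spec_poly (Suc n) W * \<Delta> ^ ?v) k = poly (D ^ 3 ^ n * \<Psi> ^ ?v * pcompose (spec_poly n (renorm W)) R) k"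
      using decimation_det[of n]
      by (simp add: poly_power poly_pcompose poly_spec_poly D mult.commute[of _ "poly \<Delta> k ^ ?v"] del: cells.simps)
  qed
  then have "proots (spec_poly (Suc n) W * \<Delta> ^ ?v) = proots (D ^ 3 ^ n * \<Psi> ^ ?v * pcompose (spec_poly n (renorm W)) R)"
    by simp
  moreover have "pcompose (spec_poly n (renorm W)) R \<noteq> 0"
    using spec_poly_nonzero R by (simp add: pcompose_eq_0_iff)
  ultimately show ?thesis
    using nz spec_poly_nonzero R by (simp add: proots_mult proots_power proots_pcompose)
qed

text \<open>With \<open>e * f = 1\<close> the condition on \<open>A\<close> and \<open>B\<close>
  reads \<open>A / 2 + B * t = 0\<close>, which is solved by \<open>A = t\<close> and
  \<open>B = -1/2\<close>.\<close>

lemma spec_step_00: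
  assumes "has_flux 1 1 W"
  shows "proots (spec_poly (Suc n) W) + repeat_mset (card (vert n)) {#1/2, 5/4#}
    = repeat_mset (3 ^ n) {#1/2, 5/4, 5/4#} + replicate_mset (card (vert n)) (3/2) + preim_mset R00 (proots (spec_poly n (renorm W)))"
proof -
  have "decimation W 1 1 (k - 1) (k - 1) (- 1/2) (poly ([:- (1/2), 1:] * [:- (5/4), 1:]) k) (poly (Polynomial.smult (- (1/4)) [:- (3/2), 1:]) k) (poly R00 k - 1)" for k
    using assms by unfold_locales (simp_all add: R00_def field_simps power2_eq_square)
  then have "proots (spec_poly (Suc n) W) + repeat_mset (card (vert n)) (proots ([:- (1/2), 1:] * [:- (5/4), 1:]))
    = repeat_mset (3 ^ n) (proots ([:- (1/2), 1:] * [:- (5/4), 1:] * [:- (5/4), 1:]))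
      + repeat_mset (card (vert n)) (proots (Polynomial.smult (- (1/4)) [:- (3/2), 1:])) + preim_mset R00 (proots (spec_poly n (renorm W)))"
    by (rule spec_step) (simp_all add: R00_def field_simps power2_eq_square)
  then show ?thesis
    unfolding proots_linear_1 proots_linear_2 proots_linear_3 by simp
qed

lemma spec_step_hh:
  assumes "has_flux (-1) (-1) W"
  shows "proots (spec_poly (Suc n) W) + repeat_mset (card (vert n)) {#3/2, 3/4#}
    = repeat_mset (3 ^ n) {#3/2, 3/4, 3/4#} + replicate_mset (card (vert n)) (1/2) + preim_mset Rhh (proots (spec_poly n (renorm W)))"
proof -
  have "decimation W (-1) (-1) (k - 1) (k - 1) (- 1/2) (poly ([:- (3/2), 1:] * [:- (3/4), 1:]) k) (poly (Polynomial.smult (- (1/4)) [:- (1/2), 1:]) k) (poly Rhh k - 1)" for k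
    using assms by unfold_locales (simp_all add: Rhh_def field_simps power2_eq_square)
  then have "proots (spec_poly (Suc n) W) + repeat_mset (card (vert n)) (proots ([:- (3/2), 1:] * [:- (3/4), 1:]))
    = repeat_mset (3 ^ n) (proots ([:- (3/2), 1:] * [:- (3/4), 1:] * [:- (3/4), 1:]))
      + repeat_mset (card (vert n)) (proots (Polynomial.smult (- (1/4)) [:- (1/2), 1:])) + preim_mset Rhh (proots (spec_poly n (renorm W)))"
    by (rule spec_step) (simp_all add: Rhh_def field_simps power2_eq_square)
  then show ?thesis
    unfolding proots_linear_1 proots_linear_2 proots_linear_3 by simp
qed

text \<open>Here \<open>e * f = -1\<close> forces \<open>B = 0\<close>. The choice
  \<open>A = 1\<close> makes \<open>\<psi>\<close> constant, so it contributes no roots.\<close>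

lemma spec_step_h0:
  assumes "has_flux (-1) 1 W"
  shows "proots (spec_poly (Suc n) W) + repeat_mset (card (vert n)) {#5/4#}
    = repeat_mset (3 ^ n) {#1/2, 5/4, 5/4#} + preim_mset Rh0 (proots (spec_poly n (renorm W)))"
proof -
  have "decimation W (-1) 1 (k - 1) 1 0 (poly ([:- (5/4), 1:]) k) (poly ([:- (1/4):]) k) (poly Rh0 k - 1)" for k
    using assms by unfold_locales (simp_all add: Rh0_def field_simps power2_eq_square)
  then have "proots (spec_poly (Suc n) W) + repeat_mset (card (vert n)) (proots ([:- (5/4), 1:]))
    = repeat_mset (3 ^ n) (proots ([:- (1/2), 1:] * [:- (5/4), 1:] * [:- (5/4), 1:]))
      + repeat_mset (card (vert n)) (proots ([:- (1/4):])) + preim_mset Rh0 (proots (spec_poly n (renorm W)))"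
    by (rule spec_step) (simp_all add: Rh0_def field_simps power2_eq_square)
  then show ?thesis
    unfolding proots_linear_1 proots_linear_2 proots_linear_3 by simp
qed

lemma spec_step_0h:
  assumes "has_flux 1 (-1) W"
  shows "proots (spec_poly (Suc n) W) + repeat_mset (card (vert n)) {#3/4#}
    = repeat_mset (3 ^ n) {#3/2, 3/4, 3/4#} + preim_mset R0h (proots (spec_poly n (renorm W)))"
proof -
  have "decimation W 1 (-1) (k - 1) 1 0 (poly ([:- (3/4), 1:]) k) (poly ([:- (1/4):]) k) (poly R0h k - 1)" for k
    using assms by unfold_locales (simp_all add: R0h_def field_simps power2_eq_square)
  then have "proots (spec_poly (Suc n) W) + repeat_mset (card (vert n)) (proots ([:- (3/4), 1:]))
    = repeat_mset (3 ^ n) (proots ([:- (3/2), 1:] * [:- (3/4), 1:] * [:- (3/4), 1:]))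
      + repeat_mset (card (vert n)) (proots ([:- (1/4):])) + preim_mset R0h (proots (spec_poly n (renorm W)))"
    by (rule spec_step) (simp_all add: R0h_def field_simps power2_eq_square)
  then show ?thesis
    unfolding proots_linear_1 proots_linear_2 proots_linear_3 by simp
qed

text \<open>The values \<open>0\<close> and \<open>3/2\<close> come from the spectrum at flux
  \<open>(0,0)\<close>, and \<open>1/2\<close> and \<open>2\<close> from that at
  \<open>(1/2,1/2)\<close>. Their preimages are explicit and partly cancel against the roots of
  \<open>\<delta>\<close>.\<close>

lemma preim_values:
  "preim R00 (Suc 0) 0 = {#0, 5/4#}" "preim R00 (Suc 0) (3/2) = {#1/2, 3/4#}"
  "preim Rhh (Suc 0) 0 = {#2, 3/4#}" "preim Rhh (Suc 0) (3/2) = {#3/2, 5/4#}"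
  "preim Rh0 (Suc 0) (1/2) = {#1/2, 7/4#}" "preim Rh0 (Suc 0) 2 = {#1, 5/4#}"
  "preim R0h (Suc 0) (1/2) = {#3/2, 1/4#}" "preim R0h (Suc 0) 2 = {#1, 3/4#}"
  unfolding R00_def Rhh_def Rh0_def R0h_def
  by (rule preim_quadratic; simp)+

lemma spec_0:
  assumes "has_flux 1 1 W"
  shows "proots (spec_poly 0 W) = {#0, 3/2, 3/2#}"
proof -
  define p q r :: "int \<times> int" where "p = (0, 0)" and "q = (1, 0)" and "r = (0, 1)"
  have "hol W 1 (0, 0) (0 + 1, 0) (0, 0 + 1)" using assms unfolding has_flux_def by blast
  then have h: "hol W 1 p q r" by (simp add: p_def q_def r_def)
  have h': "hol W 1 p r q" by (rule hol_flip[OF h]) simp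
  have inv: "W p q * W q p = 1" "W q r * W r q = 1" "W p r * W r p = 1"
    and loop: "W p q * W q r * W r p = 1" "W p r * W r q * W q p = 1"
    using h h' by (auto simp: hol_def)
  have vert: "vert 0 = {p, q, r}" by (auto simp: vert_def tri_def p_def q_def r_def)
  have ne: "p \<noteq> q" "q \<noteq> p" "p \<noteq> r" "r \<noteq> p" "q \<noteq> r" "r \<noteq> q" by (simp_all add: p_def q_def r_def)
  then have dist: "distinct [p, q, r]" by simp
  have lap: "lap_mat 0 W t x y = (if x = y then t else W x y / 2)" if "x \<in> vert 0" "y \<in> vert 0" for x y t
  proof -
    have "{c \<in> cells 0. x \<in> tri c} = {(0, 0)}" using that by (auto simp: vert_def)
    then have "deg 0 x = 2" by (simp add: deg_def)
    then show ?thesis using that by (auto simp: lap_mat_def adj_def vert_def)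
  qed
  have "spec_poly 0 W = [:- 0, 1:] * [:- (3/2), 1:] * [:- (3/2), 1:]"
  proof (rule iffD1[OF poly_eq_poly_eq_iff], rule ext)
    fix k :: complex
    let ?t = "k - 1"
    have "poly (spec_poly 0 W) k = fdet {p, q, r} (\<lambda>x y. if x = y then ?t else W x y / 2)"
      unfolding poly_spec_poly vert by (rule fdet_cong) (use lap vert in auto)
    also have "\<dots> = ?t * (?t * ?t - W q r / 2 * (W r q / 2)) - W p q / 2 * (W q p / 2 * ?t - W q r / 2 * (W r p / 2))
      + W p r / 2 * (W q p / 2 * (W r q / 2) - ?t * (W r p / 2))"
      unfolding fdet_3[OF dist] using ne by simp
    also have "\<dots> = ?t ^ 3 - ?t / 4 * (W q r * W r q) - ?t / 4 * (W p q * W q p) - ?t / 4 * (W p r * W r p)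
      + (W p q * W q r * W r p) / 8 + (W p r * W r q * W q p) / 8"
      by (simp add: field_simps power3_eq_cube)
    \<comment> \<open>With \<open>t = k - 1\<close> the determinant is
      \<open>t^3 - 3 t / 4 + 1/4 = (t + 1) (t - 1/2)^2\<close>.\<close>
    also have "\<dots> = k * (k - 3/2) * (k - 3/2)"
      unfolding inv loop by (simp add: field_simps power3_eq_cube)
    also have "\<dots> = poly ([:- 0, 1:] * [:- (3/2), 1:] * [:- (3/2), 1:]) k" by (simp add: field_simps)
    finally show "poly (spec_poly 0 W) k = poly ([:- 0, 1:] * [:- (3/2), 1:] * [:- (3/2), 1:]) k" .
  qed
  then show ?thesis by (simp only: proots_linear_3)
qed

lemma has_flux_renorm_cases:
  "has_flux 1 1 W \<Longrightarrow> has_flux 1 1 (renorm W)"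
  "has_flux (-1) (-1) W \<Longrightarrow> has_flux 1 1 (renorm W)"
  "has_flux (-1) 1 W \<Longrightarrow> has_flux (-1) (-1) (renorm W)"
  "has_flux 1 (-1) W \<Longrightarrow> has_flux (-1) (-1) (renorm W)"
  using has_flux_renorm[of 1 1 W] has_flux_renorm[of "-1" "-1" W] has_flux_renorm[of "-1" 1 W] has_flux_renorm[of 1 "-1" W]
  by simp_all

section \<open>Closed forms of the spectra\<close>

text \<open>With \<open>3 ^ n = 2 * m + 1\<close> every multiplicity involving \<open>div 2\<close>
  becomes linear in \<open>m\<close>.\<close>

lemma power_3_odd: obtains m :: nat where "3 ^ n = 2 * m + 1"
  using oddE[of "3 ^ n :: nat"] by auto

lemma degree_R00: "degree R00 > 0"
  by (simp add: R00_def)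

text \<open>Flux zero reproduces itself, so this is an induction: preimages of the sums at level
  \<open>n\<close> supply the terms with \<open>k > 0\<close>, and the terms with
  \<open>k = 0\<close> are newly created.\<close>

lemma spec_00:
  assumes "has_flux 1 1 W"
  shows "proots (spec_poly n W) = {#0#} + replicate_mset ((3 ^ n + 3) div 2) (3/2)
    + (\<Sum>k<n. repeat_mset ((3 ^ (n - k - 1) + 3) div 2) (preim R00 k (3/4)))
    + (\<Sum>k<n. repeat_mset ((3 ^ (n - k - 1) - 1) div 2) (preim R00 k (5/4)))"
  using assms
proof (induction n arbitrary: W)
  case 0
  have "(3 ^ 0 + 3) div 2 = (2 :: nat)" by simp
  then show ?case using spec_0[OF 0] by (simp only:) (simp add: numeral_2_eq_2)
next
  case (Suc n)
  define S3 where "S3 = (\<Sum>k<n. repeat_mset ((3 ^ (n - k - 1) + 3) div 2) (preim R00 (Suc k) (3/4)))"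
  define S5 where "S5 = (\<Sum>k<n. repeat_mset ((3 ^ (n - k - 1) - 1) div 2) (preim R00 (Suc k) (5/4)))"
  have sums: "(\<Sum>k<Suc n. repeat_mset ((3 ^ (Suc n - k - 1) + 3) div 2) (preim R00 k (3/4)))
      = replicate_mset ((3 ^ n + 3) div 2) (3/4) + S3"
    "(\<Sum>k<Suc n. repeat_mset ((3 ^ (Suc n - k - 1) - 1) div 2) (preim R00 k (5/4)))
      = replicate_mset ((3 ^ n - 1) div 2) (5/4) + S5"
    unfolding sum.lessThan_Suc_shift S3_def S5_def by (simp_all add: preim_zero)
  obtain m :: nat where m: "3 ^ n = 2 * m + 1" by (rule power_3_odd)
  have "preim_mset R00 (proots (spec_poly n (renorm W))) = {#0, 5/4#} + repeat_mset (m + 2) {#1/2, 3/4#} + S3 + S5"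
    unfolding Suc.IH[OF has_flux_renorm_cases(1)[OF Suc.prems]] S3_def S5_def
    by (simp add: preim_values preim_Suc[OF degree_R00, symmetric] m)
  note pre = this
  have v: "card (vert n) = 3 * m + 3" by (simp add: card_vert m)
  have "proots (spec_poly (Suc n) W) + repeat_mset (3 * m + 3) {#1/2, 5/4#}
      = repeat_mset (2 * m + 1) {#1/2, 5/4, 5/4#} + replicate_mset (3 * m + 3) (3/2)
        + ({#0, 5/4#} + repeat_mset (m + 2) {#1/2, 3/4#} + S3 + S5)"
    using spec_step_00[OF Suc.prems, of n] unfolding v m pre .
  \<comment> \<open>All \<open>3 * m + 3\<close> copies of \<open>1/2\<close> cancel, and of the
    \<open>4 * m + 3\<close> copies of \<open>5/4\<close> exactly \<open>m\<close> survive.\<close>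
  also have "\<dots> = ({#0#} + replicate_mset (3 * m + 3) (3/2) + (replicate_mset (m + 2) (3/4) + S3) + (replicate_mset m (5/4) + S5))
      + repeat_mset (3 * m + 3) {#1/2, 5/4#}"
    by (rule multiset_eqI) simp
  finally show ?case unfolding sums by (simp add: m add.commute[of 3 "3 * m"])
qed

lemma spec_hh:
  assumes "has_flux (-1) (-1) W"
  shows "proots (spec_poly (Suc n) W) = replicate_mset ((3 ^ Suc n + 3) div 2) (1/2)
    + replicate_mset ((3 ^ n - 1) div 2) (3/4) + replicate_mset ((3 ^ n + 3) div 2) (5/4) + {#2#}
    + (\<Sum>k<n. repeat_mset ((3 ^ (n - k - 1) + 3) div 2) (preim_mset Rhh (preim R00 k (3/4))))
    + (\<Sum>k<n - 1. repeat_mset ((3 ^ (n - k - 1) - 1) div 2) (preim_mset Rhh (preim R00 k (5/4))))"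
proof -
  define S3 where "S3 = (\<Sum>k<n. repeat_mset ((3 ^ (n - k - 1) + 3) div 2) (preim_mset Rhh (preim R00 k (3/4))))"
  define S5 where "S5 = (\<Sum>k<n - 1. repeat_mset ((3 ^ (n - k - 1) - 1) div 2) (preim_mset Rhh (preim R00 k (5/4))))"
  \<comment> \<open>The term \<open>k = n - 1\<close> has multiplicity
    \<open>(3^0 - 1) / 2 = 0\<close>, hence the shorter range.\<close>
  have S5: "(\<Sum>k<n. repeat_mset ((3 ^ (n - k - 1) - 1) div 2) (preim_mset Rhh (preim R00 k (5/4)))) = S5"
    unfolding S5_def by (cases n) simp_all
  obtain m :: nat where m: "3 ^ n = 2 * m + 1" by (rule power_3_odd)
  have "preim_mset Rhh (proots (spec_poly n (renorm W))) = {#2, 3/4#} + repeat_mset (m + 2) {#3/2, 5/4#} + S3 + S5"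
    unfolding spec_00[OF has_flux_renorm_cases(2)[OF assms]] S3_def S5[symmetric]
    by (simp add: preim_values m)
  note pre = this
  have v: "card (vert n) = 3 * m + 3" by (simp add: card_vert m)
  have "proots (spec_poly (Suc n) W) + repeat_mset (3 * m + 3) {#3/2, 3/4#}
      = repeat_mset (2 * m + 1) {#3/2, 3/4, 3/4#} + replicate_mset (3 * m + 3) (1/2)
        + ({#2, 3/4#} + repeat_mset (m + 2) {#3/2, 5/4#} + S3 + S5)"
    using spec_step_hh[OF assms, of n] unfolding v m pre .
  \<comment> \<open>All copies of \<open>3/2\<close> cancel, and \<open>m\<close> of the
    \<open>4 * m + 3\<close> copies of \<open>3/4\<close> survive.\<close>
  also have "\<dots> = (replicate_mset (3 * m + 3) (1/2) + replicate_mset m (3/4) + replicate_mset (m + 2) (5/4) + {#2#} + S3 + S5)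
      + repeat_mset (3 * m + 3) {#3/2, 3/4#}"
    by (rule multiset_eqI) simp
  finally show ?thesis unfolding S3_def[symmetric] S5_def[symmetric] by (simp add: m add.commute[of 3 "3 * m"])
qed

lemma spec_h0:
  assumes "has_flux (-1) 1 W"
  shows "proots (spec_poly (Suc (Suc n)) W) = replicate_mset ((3 ^ Suc (Suc n) + 3) div 2) (1/2) + {#1#}
    + replicate_mset ((3 ^ Suc n - 1) div 2) (5/4) + replicate_mset ((3 ^ Suc n + 3) div 2) (7/4)
    + repeat_mset ((3 ^ n - 1) div 2) (preim Rh0 (Suc 0) (3/4)) + repeat_mset ((3 ^ n + 3) div 2) (preim Rh0 (Suc 0) (5/4))
    + (\<Sum>k<n. repeat_mset ((3 ^ (n - k - 1) + 3) div 2) (preim_mset Rh0 (preim_mset Rhh (preim R00 k (3/4)))))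
    + (\<Sum>k<n - 1. repeat_mset ((3 ^ (n - k - 1) - 1) div 2) (preim_mset Rh0 (preim_mset Rhh (preim R00 k (5/4)))))"
proof -
  define S3 where "S3 = (\<Sum>k<n. repeat_mset ((3 ^ (n - k - 1) + 3) div 2) (preim_mset Rh0 (preim_mset Rhh (preim R00 k (3/4)))))"
  define S5 where "S5 = (\<Sum>k<n - 1. repeat_mset ((3 ^ (n - k - 1) - 1) div 2) (preim_mset Rh0 (preim_mset Rhh (preim R00 k (5/4)))))"
  define P3 P5 where "P3 = preim Rh0 (Suc 0) (3/4)" and "P5 = preim Rh0 (Suc 0) (5/4)"
  obtain m :: nat where m: "3 ^ n = 2 * m + 1" by (rule power_3_odd)
  have "preim_mset Rh0 (proots (spec_poly (Suc n) (renorm W)))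
      = repeat_mset (3 * m + 3) {#1/2, 7/4#} + repeat_mset m P3 + repeat_mset (m + 2) P5 + {#1, 5/4#} + S3 + S5"
    unfolding spec_hh[OF has_flux_renorm_cases(3)[OF assms]] S3_def S5_def P3_def P5_def
    by (simp add: preim_values m add.commute[of 3 "3 * m"])
  note pre = this
  have v: "card (vert (Suc n)) = 9 * m + 6" and p: "3 ^ Suc n = 6 * m + 3" by (simp_all add: card_vert m)
  have "proots (spec_poly (Suc (Suc n)) W) + repeat_mset (9 * m + 6) {#5/4#}
      = repeat_mset (6 * m + 3) {#1/2, 5/4, 5/4#}
        + (repeat_mset (3 * m + 3) {#1/2, 7/4#} + repeat_mset m P3 + repeat_mset (m + 2) P5 + {#1, 5/4#} + S3 + S5)"
    using spec_step_h0[OF assms, of "Suc n"] unfolding v p pre .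
  \<comment> \<open>The eigenvalue \<open>1/2\<close> arises both from the midpoint determinant and
    as its own preimage, \<open>6 * m + 3\<close> and \<open>3 * m + 3\<close> times; of
    \<open>12 * m + 7\<close> copies of \<open>5/4\<close> there remain
    \<open>3 * m + 1\<close>.\<close>
  also have "\<dots> = (replicate_mset (9 * m + 6) (1/2) + {#1#} + replicate_mset (3 * m + 1) (5/4) + replicate_mset (3 * m + 3) (7/4)
      + repeat_mset m P3 + repeat_mset (m + 2) P5 + S3 + S5) + repeat_mset (9 * m + 6) {#5/4#}"
    by (rule multiset_eqI) simp
  finally show ?thesis unfolding S3_def[symmetric] S5_def[symmetric] P3_def[symmetric] P5_def[symmetric]
    by (simp add: m add.commute[of 3 "3 * m"] add.commute[of 6 "9 * m"])
qed

lemma spec_0h: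
  assumes "has_flux 1 (-1) W"
  shows "proots (spec_poly (Suc (Suc n)) W) = replicate_mset ((3 ^ Suc n + 3) div 2) (1/4)
    + replicate_mset ((3 ^ Suc n - 1) div 2) (3/4) + {#1#} + replicate_mset ((3 ^ Suc (Suc n) + 3) div 2) (3/2)
    + repeat_mset ((3 ^ n - 1) div 2) (preim R0h (Suc 0) (3/4)) + repeat_mset ((3 ^ n + 3) div 2) (preim R0h (Suc 0) (5/4))
    + (\<Sum>k<n. repeat_mset ((3 ^ (n - k - 1) + 3) div 2) (preim_mset R0h (preim_mset Rhh (preim R00 k (3/4)))))
    + (\<Sum>k<n - 1. repeat_mset ((3 ^ (n - k - 1) - 1) div 2) (preim_mset R0h (preim_mset Rhh (preim R00 k (5/4)))))"
proof -
  define S3 where "S3 = (\<Sum>k<n. repeat_mset ((3 ^ (n - k - 1) + 3) div 2) (preim_mset R0h (preim_mset Rhh (preim R00 k (3/4)))))"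
  define S5 where "S5 = (\<Sum>k<n - 1. repeat_mset ((3 ^ (n - k - 1) - 1) div 2) (preim_mset R0h (preim_mset Rhh (preim R00 k (5/4)))))"
  define P3 P5 where "P3 = preim R0h (Suc 0) (3/4)" and "P5 = preim R0h (Suc 0) (5/4)"
  obtain m :: nat where m: "3 ^ n = 2 * m + 1" by (rule power_3_odd)
  have "preim_mset R0h (proots (spec_poly (Suc n) (renorm W)))
      = repeat_mset (3 * m + 3) {#3/2, 1/4#} + repeat_mset m P3 + repeat_mset (m + 2) P5 + {#1, 3/4#} + S3 + S5"
    unfolding spec_hh[OF has_flux_renorm_cases(4)[OF assms]] S3_def S5_def P3_def P5_def
    by (simp add: preim_values m add.commute[of 3 "3 * m"])
  note pre = this
  have v: "card (vert (Suc n)) = 9 * m + 6" and p: "3 ^ Suc n = 6 * m + 3" by (simp_all add: card_vert m)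
  have "proots (spec_poly (Suc (Suc n)) W) + repeat_mset (9 * m + 6) {#3/4#}
      = repeat_mset (6 * m + 3) {#3/2, 3/4, 3/4#}
        + (repeat_mset (3 * m + 3) {#3/2, 1/4#} + repeat_mset m P3 + repeat_mset (m + 2) P5 + {#1, 3/4#} + S3 + S5)"
    using spec_step_0h[OF assms, of "Suc n"] unfolding v p pre .
  \<comment> \<open>Now \<open>3/2\<close> comes from the midpoint determinant and from the
    preimages of \<open>1/2\<close>, and \<open>3 * m + 1\<close> copies of \<open>3/4\<close>
    remain.\<close>
  also have "\<dots> = (replicate_mset (3 * m + 3) (1/4) + replicate_mset (3 * m + 1) (3/4) + {#1#} + replicate_mset (9 * m + 6) (3/2)
      + repeat_mset m P3 + repeat_mset (m + 2) P5 + S3 + S5) + repeat_mset (9 * m + 6) {#3/4#}"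
    by (rule multiset_eqI) simp
  finally show ?thesis unfolding S3_def[symmetric] S5_def[symmetric] P3_def[symmetric] P5_def[symmetric]
    by (simp add: m add.commute[of 3 "3 * m"] add.commute[of 6 "9 * m"])
qed

lemma exp_flux: "exp (2 * pi * \<i> * of_real (1/2)) = -1" "exp (2 * pi * \<i> * of_real 0) = (1 :: complex)"
  using exp_pi_i by (simp_all add: mult.commute)

theorem theorem1p3:
  shows
  "(\<forall>N w. N \<ge> 1 \<longrightarrow> conn_with_flux (1/2) (1/2) w \<longrightarrow>
     sg_spectrum N w =
       replicate_mset ((3 ^ N + 3) div 2) (1/2)
     + replicate_mset ((3 ^ (N - 1) - 1) div 2) (3/4)
     + replicate_mset ((3 ^ (N - 1) + 3) div 2) (5/4)
     + replicate_mset 1 2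
     + (\<Sum>k\<in>{..<N - 1}. repeat_mset ((3 ^ (N - k - 2) + 3) div 2) (preim_mset Rhh (preim R00 k (3/4))))
     + (\<Sum>k\<in>{..<N - 2}. repeat_mset ((3 ^ (N - k - 2) - 1) div 2) (preim_mset Rhh (preim R00 k (5/4)))))
   \<and>
   (\<forall>N w. N \<ge> 2 \<longrightarrow> conn_with_flux (1/2) 0 w \<longrightarrow>
     sg_spectrum N w =
       replicate_mset ((3 ^ N + 3) div 2) (1/2)
     + replicate_mset 1 1
     + replicate_mset ((3 ^ (N - 1) - 1) div 2) (5/4)
     + replicate_mset ((3 ^ (N - 1) + 3) div 2) (7/4)
     + repeat_mset ((3 ^ (N - 2) - 1) div 2) (preim Rh0 1 (3/4))
     + repeat_mset ((3 ^ (N - 2) + 3) div 2) (preim Rh0 1 (5/4))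
     + (\<Sum>k\<in>{..<N - 2}. repeat_mset ((3 ^ (N - k - 3) + 3) div 2)
           (preim_mset Rh0 (preim_mset Rhh (preim R00 k (3/4)))))
     + (\<Sum>k\<in>{..<N - 3}. repeat_mset ((3 ^ (N - k - 3) - 1) div 2)
           (preim_mset Rh0 (preim_mset Rhh (preim R00 k (5/4))))))
   \<and>
   (\<forall>N w. N \<ge> 2 \<longrightarrow> conn_with_flux 0 (1/2) w \<longrightarrow>
     sg_spectrum N w =
       replicate_mset ((3 ^ (N - 1) + 3) div 2) (1/4)
     + replicate_mset ((3 ^ (N - 1) - 1) div 2) (3/4)
     + replicate_mset 1 1
     + replicate_mset ((3 ^ N + 3) div 2) (3/2)
     + repeat_mset ((3 ^ (N - 2) - 1) div 2) (preim R0h 1 (3/4))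
     + repeat_mset ((3 ^ (N - 2) + 3) div 2) (preim R0h 1 (5/4))
     + (\<Sum>k\<in>{..<N - 2}. repeat_mset ((3 ^ (N - k - 3) + 3) div 2)
           (preim_mset R0h (preim_mset Rhh (preim R00 k (3/4)))))
     + (\<Sum>k\<in>{..<N - 3}. repeat_mset ((3 ^ (N - k - 3) - 1) div 2)
           (preim_mset R0h (preim_mset Rhh (preim R00 k (5/4))))))"
proof (intro conjI allI impI)
  fix N :: nat and w
  assume N: "N \<ge> 1" and w: "conn_with_flux (1/2) (1/2) w"
  obtain n where n: "N = Suc n" using N by (cases N) auto
  \<comment> \<open>Subtraction is truncated; for \<open>N = 1\<close> the index ranges of both sums
    are empty.\<close>
  have e: "Suc n - k - 2 = n - k - 1" "Suc n - 2 = n - 1" for k by auto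
  show "sg_spectrum N w = 
       replicate_mset ((3 ^ N + 3) div 2) (1/2)
     + replicate_mset ((3 ^ (N - 1) - 1) div 2) (3/4)
     + replicate_mset ((3 ^ (N - 1) + 3) div 2) (5/4)
     + replicate_mset 1 2
     + (\<Sum>k\<in>{..<N - 1}. repeat_mset ((3 ^ (N - k - 2) + 3) div 2) (preim_mset Rhh (preim R00 k (3/4))))
     + (\<Sum>k\<in>{..<N - 2}. repeat_mset ((3 ^ (N - k - 2) - 1) div 2) (preim_mset Rhh (preim R00 k (5/4))))"
    unfolding n sg_spectrum_eq spec_hh[OF has_flux_conn[OF w, unfolded exp_flux]] e by simp
next
  fix N :: nat and w
  assume N: "N \<ge> 2" and w: "conn_with_flux (1/2) 0 w"
  obtain n where n: "N = Suc (Suc n)" using N by (metis Suc_le_D numeral_2_eq_2 Suc_le_mono)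
  have e: "Suc (Suc n) - k - 3 = n - k - 1" "Suc (Suc n) - 3 = n - 1" for k by auto
  show "sg_spectrum N w = 
       replicate_mset ((3 ^ N + 3) div 2) (1/2)
     + replicate_mset 1 1
     + replicate_mset ((3 ^ (N - 1) - 1) div 2) (5/4)
     + replicate_mset ((3 ^ (N - 1) + 3) div 2) (7/4)
     + repeat_mset ((3 ^ (N - 2) - 1) div 2) (preim Rh0 1 (3/4))
     + repeat_mset ((3 ^ (N - 2) + 3) div 2) (preim Rh0 1 (5/4))
     + (\<Sum>k\<in>{..<N - 2}. repeat_mset ((3 ^ (N - k - 3) + 3) div 2)
           (preim_mset Rh0 (preim_mset Rhh (preim R00 k (3/4)))))
     + (\<Sum>k\<in>{..<N - 3}. repeat_mset ((3 ^ (N - k - 3) - 1) div 2)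
           (preim_mset Rh0 (preim_mset Rhh (preim R00 k (5/4)))))"
    unfolding n sg_spectrum_eq spec_h0[OF has_flux_conn[OF w, unfolded exp_flux]] e by simp
next
  fix N :: nat and w
  assume N: "N \<ge> 2" and w: "conn_with_flux 0 (1/2) w"
  obtain n where n: "N = Suc (Suc n)" using N by (metis Suc_le_D numeral_2_eq_2 Suc_le_mono)
  have e: "Suc (Suc n) - k - 3 = n - k - 1" "Suc (Suc n) - 3 = n - 1" for k by auto
  show "sg_spectrum N w = 
       replicate_mset ((3 ^ (N - 1) + 3) div 2) (1/4)
     + replicate_mset ((3 ^ (N - 1) - 1) div 2) (3/4)
     + replicate_mset 1 1
     + replicate_mset ((3 ^ N + 3) div 2) (3/2)
     + repeat_mset ((3 ^ (N - 2) - 1) div 2) (preim R0h 1 (3/4))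
     + repeat_mset ((3 ^ (N - 2) + 3) div 2) (preim R0h 1 (5/4))
     + (\<Sum>k\<in>{..<N - 2}. repeat_mset ((3 ^ (N - k - 3) + 3) div 2)
           (preim_mset R0h (preim_mset Rhh (preim R00 k (3/4)))))
     + (\<Sum>k\<in>{..<N - 3}. repeat_mset ((3 ^ (N - k - 3) - 1) div 2)
           (preim_mset R0h (preim_mset Rhh (preim R00 k (5/4)))))"
    unfolding n sg_spectrum_eq spec_0h[OF has_flux_conn[OF w, unfolded exp_flux]] e by simp
qed

end
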